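(* Let $f:\mathbb{R}^n\to\mathbb{R}$ be twice continuously differentiable. Suppose the problem $(\mathrm{P_{1a}})$ of minimizing $f(x)$ over $x\in\Delta_n$ has the strict saddle property, that all its local minimizers are global minimizers, and that all its second-order KKT points are non-degenerate. Then, for $\epsilon>0$ small enough, with high probability the algorithm HadPRGD finds an iterate $x_k$ satisfying $$f(x_k)-\min_{x\in\Delta_n}f(x)\le\epsilon$$ within $K=\mathcal{O}((\log n)^4/\epsilon)$ iterations.
   Context: Notation: $[x]_i$ is the $i$th entry of $x$; $\odot$ is the entrywise product; $1_n$ is the all-ones vector; vector inequalities are entrywise; $\Delta_n=\{x\in\mathbb{R}^n:1_n^\top x=1,\ x\ge0\}$; $\mathcal{S}_{n-1}=\{z\in\mathbb{R}^n:\|z\|_2=1\}$; $g(z)=f(z\odot z)$, viewed as a function on the Riemannian manifold $\mathcal{S}_{n-1}$ with tangent spaces $T_z\mathcal{S}_{n-1}=\{v:v^\top z=0\}$, exponential map $\exp_z$ (moving along great circles), Riemannian gradient $\operatorname{grad}g$ and Riemannian Hessian $\operatorname{Hess}g$. The pullback of $g$ at $z$ is $\hat g_z=g\circ\exp_z:T_z\mathcal{S}_{n-1}\to\mathbb{R}$. Second-order KKT point of $(\mathrm{P_{1a}})$: a point $x^\star$ such that there exist $\lambda^\star\in\mathbb{R}$, $\beta^\star\in\mathbb{R}^n$ with $\nabla f(x^\star)=\lambda^\star 1_n+\beta^\star$, $x^\star\ge 0$, $\beta^\star\ge 0$, $x^\star\odot\beta^\star=0$, $1_n^\top x^\star=1$;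 and $u^\top\nabla^2 f(x^\star)u\ge 0$ for all $u$ with $1_n^\top u=0$ and $[u]_i=0$ whenever $[x^\star]_i=0$. It is non-degenerate if moreover these hold with strict complementary slackness, $[\beta^\star]_j>0$ for all $j$ with $[x^\star]_j=0$, and with $u^\top\nabla^2 f(x^\star)u>0$ for all $u\neq0$ with $1_n^\top u=0$ and $[u]_i=0$ whenever $[x^\star]_i=0$. The problem has the strict saddle property if every second-order KKT point is a local minimizer. Algorithm HadPRGD (Hadamard parametrization plus the Perturbed Riemannian Gradient Descent, PRGD, of Criscitiello and Boumal). Inputs: $x_0\in\Delta_n$, a step size $\alpha>0$, a tolerance $\hat\epsilon>0$ (which may be chosen depending on the target accuracy $\epsilon$), and PRGD parameters $\eta,r,b>0$ and $\mathcal{T}\in\mathbb{N}$. Set $z_0=\sqrt{x_0}$ entrywise. At step $k$: if $\|\operatorname{grad}g(z_k)\|_2>\hat\epsilon$, set $z_{k+1}=\exp_{z_k}(-\alpha\operatorname{grad}g(z_k))$. Otherwise draw $\xi$ uniformly from the ball of radius $r$ centered at $0$ in $T_{z_k}\mathcal{S}_{n-1}$, set $s_0=\eta\xi$, and perform tangent-space steps $s_{j+1}=s_j-\eta\nabla\hat g_{z_k}(s_j)$ for up to $\mathcal{T}$ steps; if some $\|s_{j+1}\|_2\ge b$, instead set $s_{\mathcal{T}}=s_j-\alpha'\eta\nabla\hat g_{z_k}(s_j)$ with $\alpha'\in(0,1]$ such that $\|s_{\mathcal{T}}\|_2=b$ and stop; then set $z_{k+\mathcal{T}}=\exp_{z_k}(s_{\mathcal{T}})$.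 The iterates of HadPRGD are $x_k=z_k\odot z_k$. Convention on parameters and on "with high probability": the parameters are those of the known theorem of Criscitiello and Boumal for PRGD, whose guarantee is that, if $K=\mathcal{O}((\log n)^4/\hat\epsilon^2)$, then with high probability $\{z_k\}_{k=1}^K$ contains an $\hat\epsilon$-second-order stationary point of $g$, i.e. a point $z\in\mathcal{S}_{n-1}$ with $\|\operatorname{grad}g(z)\|\le\hat\epsilon$ and $\lambda_{\min}(\operatorname{Hess}g(z))\ge-\sqrt{\rho\hat\epsilon}$, where $\rho$ is the Lipschitz constant of the Hessian of the pullback of $g$. "With high probability" refers to the internal randomness of the algorithm, and $\mathcal{O}(\cdot)$ may hide constants depending on $f$, in the same sense as in that guarantee. *)

theory Defs
  imports "HOL-Probability.Probability" "HOL-Library.Landau_Symbols"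
begin

text \<open>
  On \<open>real ^ 'n\<close> the library operations \<open>*\<close>, \<open>1\<close> and \<open>\<le>\<close> are the entrywise product, the all-ones
  vector and the entrywise order; in particular \<open>1 \<bullet> x\<close> is the sum of the entries of \<open>x\<close>.
\<close>

section \<open>The problem of minimizing over the simplex\<close>

definition prob_simplex :: "(real ^ 'n) set" where
  "prob_simplex = {x. 1 \<bullet> x = 1 \<and> 0 \<le> x}"

definition gradient :: "(real ^ 'n \<Rightarrow> real) \<Rightarrow> real ^ 'n \<Rightarrow> real ^ 'n" where
  "gradient f x = (THE D. GDERIV f x :> D)"

definition hessian :: "(real ^ 'n \<Rightarrow> real) \<Rightarrow> real ^ 'n \<Rightarrow> real ^ 'n ^ 'n" where
  "hessian f x = jacobian (gradient f) (at x)"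

definition twice_cont_differentiable :: "(real ^ 'n \<Rightarrow> real) \<Rightarrow> bool" where
  "twice_cont_differentiable f \<longleftrightarrow>
     f differentiable_on UNIV \<and> gradient f differentiable_on UNIV \<and> continuous_on UNIV (hessian f)"

definition local_minimizer :: "(real ^ 'n \<Rightarrow> real) \<Rightarrow> real ^ 'n \<Rightarrow> bool" where
  "local_minimizer f x \<longleftrightarrow>
     x \<in> prob_simplex \<and> (\<exists>e>0. \<forall>y \<in> prob_simplex \<inter> ball x e. f x \<le> f y)"

definition global_minimizer :: "(real ^ 'n \<Rightarrow> real) \<Rightarrow> real ^ 'n \<Rightarrow> bool" where
  "global_minimizer f x \<longleftrightarrow> x \<in> prob_simplex \<and> (\<forall>y \<in> prob_simplex. f x \<le> f y)"

definition kkt :: "(real ^ 'n \<Rightarrow> real) \<Rightarrow> real ^ 'n \<Rightarrow> real \<Rightarrow> real ^ 'n \<Rightarrow> bool" where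
  "kkt f x l \<beta> \<longleftrightarrow>
     gradient f x = l *\<^sub>R 1 + \<beta> \<and> 0 \<le> x \<and> 0 \<le> \<beta> \<and> x * \<beta> = 0 \<and> 1 \<bullet> x = 1"

definition critical_directions :: "real ^ 'n \<Rightarrow> (real ^ 'n) set" where
  "critical_directions x = {u. 1 \<bullet> u = 0 \<and> (\<forall>i. x $ i = 0 \<longrightarrow> u $ i = 0)}"

definition second_order_kkt :: "(real ^ 'n \<Rightarrow> real) \<Rightarrow> real ^ 'n \<Rightarrow> bool" where
  "second_order_kkt f x \<longleftrightarrow>
     (\<exists>l \<beta>. kkt f x l \<beta>) \<and> (\<forall>u \<in> critical_directions x. u \<bullet> (hessian f x *v u) \<ge> 0)"

definition nondegenerate_second_order_kkt :: "(real ^ 'n \<Rightarrow> real) \<Rightarrow> real ^ 'n \<Rightarrow> bool" where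
  "nondegenerate_second_order_kkt f x \<longleftrightarrow>
     (\<exists>l \<beta>. kkt f x l \<beta> \<and> (\<forall>j. x $ j = 0 \<longrightarrow> \<beta> $ j > 0)) \<and>
     (\<forall>u \<in> critical_directions x. u \<noteq> 0 \<longrightarrow> u \<bullet> (hessian f x *v u) > 0)"

definition strict_saddle_property :: "(real ^ 'n \<Rightarrow> real) \<Rightarrow> bool" where
  "strict_saddle_property f \<longleftrightarrow> (\<forall>x. second_order_kkt f x \<longrightarrow> local_minimizer f x)"


section \<open>Riemannian geometry of the unit sphere\<close>

definition hadamard_obj :: "(real ^ 'n \<Rightarrow> real) \<Rightarrow> real ^ 'n \<Rightarrow> real" where
  "hadamard_obj f z = f (z * z)"

definition tangent_space :: "real ^ 'n \<Rightarrow> (real ^ 'n) set" where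
  "tangent_space z = {v. v \<bullet> z = 0}"

definition tangent_proj :: "real ^ 'n \<Rightarrow> real ^ 'n \<Rightarrow> real ^ 'n" where
  "tangent_proj z w = w - (w \<bullet> z) *\<^sub>R z"

text \<open>Since \<open>sgn s = s / norm s\<close> and \<open>sgn 0 = 0\<close>, the formula also covers \<open>s = 0\<close>.\<close>
definition sphere_exp :: "real ^ 'n \<Rightarrow> real ^ 'n \<Rightarrow> real ^ 'n" where
  "sphere_exp z s = cos (norm s) *\<^sub>R z + sin (norm s) *\<^sub>R sgn s"

text \<open>
  The gradient at \<open>x\<close> of a function on the embedded manifold \<open>S\<close> whose tangent space at \<open>x\<close> is \<open>T\<close>:
  the unique tangent vector representing the differential.  Only values of \<open>h\<close> on \<open>S\<close> matter.
  It is used both for \<open>S\<close> the unit sphere and for \<open>S\<close> a tangent space (a linear subspace).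
\<close>
definition gradient_on ::
    "(real ^ 'n) set \<Rightarrow> (real ^ 'n) set \<Rightarrow> (real ^ 'n \<Rightarrow> real) \<Rightarrow> real ^ 'n \<Rightarrow> real ^ 'n" where
  "gradient_on S T h x = (THE w. w \<in> T \<and> (h has_derivative (\<lambda>v. w \<bullet> v)) (at x within S))"

definition riem_grad :: "(real ^ 'n \<Rightarrow> real) \<Rightarrow> real ^ 'n \<Rightarrow> real ^ 'n" where
  "riem_grad g z = gradient_on (sphere 0 1) (tangent_space z) g z"

text \<open>
  The covariant derivative of the gradient field: for a submanifold of Euclidean space it is the
  tangential part of the derivative along a curve with velocity \<open>v\<close>, here the geodesic.
\<close>
definition riem_hess :: "(real ^ 'n \<Rightarrow> real) \<Rightarrow> real ^ 'n \<Rightarrow> real ^ 'n \<Rightarrow> real ^ 'n" where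
  "riem_hess g z v =
     tangent_proj z (vector_derivative (\<lambda>t. riem_grad g (sphere_exp z (t *\<^sub>R v))) (at 0))"

text \<open>
  The infimum is taken in \<open>ereal\<close>: it is the least eigenvalue, except that it is \<open>\<infinity>\<close> when the tangent
  space is trivial, i.e. in dimension one.
\<close>
definition riem_hess_lambda_min :: "(real ^ 'n \<Rightarrow> real) \<Rightarrow> real ^ 'n \<Rightarrow> ereal" where
  "riem_hess_lambda_min g z =
     (INF \<mu> \<in> {\<mu> :: real. \<exists>v \<in> tangent_space z. v \<noteq> 0 \<and> riem_hess g z v = \<mu> *\<^sub>R v}. ereal \<mu>)"

definition approx_second_order_stationary ::
    "(real ^ 'n \<Rightarrow> real) \<Rightarrow> real \<Rightarrow> real \<Rightarrow> real ^ 'n \<Rightarrow> bool" where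
  "approx_second_order_stationary g \<rho> e z \<longleftrightarrow>
     z \<in> sphere 0 1 \<and> norm (riem_grad g z) \<le> e \<and>
     riem_hess_lambda_min g z \<ge> ereal (- sqrt (\<rho> * e))"

definition pullback :: "(real ^ 'n \<Rightarrow> real) \<Rightarrow> real ^ 'n \<Rightarrow> real ^ 'n \<Rightarrow> real" where
  "pullback g z s = g (sphere_exp z s)"

definition pullback_grad :: "(real ^ 'n \<Rightarrow> real) \<Rightarrow> real ^ 'n \<Rightarrow> real ^ 'n \<Rightarrow> real ^ 'n" where
  "pullback_grad g z s = gradient_on (tangent_space z) (tangent_space z) (pullback g z) s"

definition pullback_hess ::
    "(real ^ 'n \<Rightarrow> real) \<Rightarrow> real ^ 'n \<Rightarrow> real ^ 'n \<Rightarrow> real ^ 'n \<Rightarrow> real ^ 'n" where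
  "pullback_hess g z s v = vector_derivative (\<lambda>t. pullback_grad g z (s + t *\<^sub>R v)) (at 0)"

text \<open>Lipschitz continuity with respect to the operator norm on each tangent space.\<close>
definition pullback_hess_lipschitz :: "(real ^ 'n \<Rightarrow> real) \<Rightarrow> real \<Rightarrow> bool" where
  "pullback_hess_lipschitz g \<rho> \<longleftrightarrow>
     0 \<le> \<rho> \<and>
     (\<forall>z \<in> sphere 0 1. \<forall>s \<in> tangent_space z. \<forall>s' \<in> tangent_space z. \<forall>v \<in> tangent_space z.
        norm (pullback_hess g z s v - pullback_hess g z s' v) \<le> \<rho> * norm (s - s') * norm v)"


section \<open>The algorithm\<close>

text \<open>
  In the notation of Criscitiello and Boumal the fields are \<open>\<alpha>\<close>, \<open>\<eta>\<close>, \<open>r\<close>, \<open>b\<close> and the number of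
  tangent space steps.
\<close>
record prgd_params =
  step_size :: real
  tangent_step_size :: real
  noise_radius :: real
  tangent_bound :: real
  tangent_steps :: nat

definition valid_params :: "prgd_params \<Rightarrow> bool" where
  "valid_params p \<longleftrightarrow>
     step_size p > 0 \<and> tangent_step_size p > 0 \<and> noise_radius p > 0 \<and> tangent_bound p > 0"

text \<open>
  The result of at most \<open>m\<close> gradient steps on the pullback, stopped on the sphere of radius \<open>b\<close>.
  If the current point has norm below \<open>b\<close> and the full step does not, then \<open>a\<close> is unique.
\<close>
primrec tangent_descent ::
    "(real ^ 'n \<Rightarrow> real) \<Rightarrow> real ^ 'n \<Rightarrow> real \<Rightarrow> real \<Rightarrow> nat \<Rightarrow> real ^ 'n \<Rightarrow> real ^ 'n" where
  "tangent_descent g z \<eta> b 0 s = s"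
| "tangent_descent g z \<eta> b (Suc m) s =
     (let d = pullback_grad g z s; s' = s - \<eta> *\<^sub>R d in
      if norm s' \<ge> b
      then (let a = (SOME a. 0 < a \<and> a \<le> 1 \<and> norm (s - (a * \<eta>) *\<^sub>R d) = b)
            in s - (a * \<eta>) *\<^sub>R d)
      else tangent_descent g z \<eta> b m s')"

text \<open>
  One pass through the loop, with the noise \<open>\<xi>\<close> as argument.  The first component is the iteration
  counter, which advances by the number of tangent space steps in a perturbed step, even if the
  latter stops early.
\<close>
definition prgd_step ::
    "(real ^ 'n \<Rightarrow> real) \<Rightarrow> real \<Rightarrow> prgd_params \<Rightarrow> real ^ 'n \<Rightarrow> nat \<times> (real ^ 'n) \<Rightarrow> nat \<times> (real ^ 'n)" where
  "prgd_step g e p \<xi> = (\<lambda>(k, z).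
     if norm (riem_grad g z) > e
     then (k + 1, sphere_exp z (- (step_size p *\<^sub>R riem_grad g z)))
     else (k + tangent_steps p,
           sphere_exp z (tangent_descent g z (tangent_step_size p) (tangent_bound p)
             (tangent_steps p) (tangent_step_size p *\<^sub>R \<xi>))))"

text \<open>
  The pairs \<open>(k, z\<^sub>k)\<close> produced by the algorithm, in order, as a function of the noise sequence.
  Indices \<open>k\<close> skipped by a perturbed step have no iterate.
\<close>
primrec prgd_path ::
    "(real ^ 'n \<Rightarrow> real) \<Rightarrow> real \<Rightarrow> prgd_params \<Rightarrow> real ^ 'n \<Rightarrow> (nat \<Rightarrow> real ^ 'n) \<Rightarrow> nat \<Rightarrow> nat \<times> (real ^ 'n)"
where
  "prgd_path g e p z \<xi> 0 = (0, z)"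
| "prgd_path g e p z \<xi> (Suc j) = prgd_step g e p (\<xi> j) (prgd_path g e p z \<xi> j)"

definition hadprgd_path ::
    "(real ^ 'n \<Rightarrow> real) \<Rightarrow> real ^ 'n \<Rightarrow> real \<Rightarrow> prgd_params \<Rightarrow> (nat \<Rightarrow> real ^ 'n) \<Rightarrow> nat \<Rightarrow> nat \<times> (real ^ 'n)"
where
  "hadprgd_path f x\<^sub>0 e p = prgd_path (hadamard_obj f) e p (\<chi> i. sqrt (x\<^sub>0 $ i))"

text \<open>
  For a unit vector \<open>z\<close> this is the uniform distribution on the ball of radius \<open>r\<close> in the tangent
  space at \<open>z\<close>: in an orthonormal basis containing \<open>z\<close>, the set below is the product of that ball
  with an interval, so projecting its uniform distribution along \<open>z\<close> leaves the normalized
  Lebesgue measure of the ball.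
\<close>
definition uniform_tangent_ball :: "real ^ 'n \<Rightarrow> real \<Rightarrow> (real ^ 'n) measure" where
  "uniform_tangent_ball z r =
     distr (uniform_measure lborel {w. \<bar>w \<bullet> z\<bar> \<le> 1 \<and> norm (tangent_proj z w) \<le> r})
       borel (tangent_proj z)"

text \<open>
  \<open>\<xi>\<close> is the noise sequence on the probability space \<open>M\<close>.  The last condition says that
  \<open>uniform_tangent_ball (z \<omega>) r\<close>, for the current point \<open>z\<close>, is the conditional distribution of \<open>\<xi> j\<close>
  given \<open>\<xi> 0, \<dots>, \<xi> (j - 1)\<close>, which determine \<open>z\<close>.  A vector is drawn in every pass; it is ignored by
  \<open>prgd_step\<close> when the gradient is large.
\<close>
definition hadprgd_run ::
    "(real ^ 'n \<Rightarrow> real) \<Rightarrow> real ^ 'n \<Rightarrow> real \<Rightarrow> prgd_params \<Rightarrow> 'w measure \<Rightarrow> (nat \<Rightarrow> 'w \<Rightarrow> real ^ 'n) \<Rightarrow> bool"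
where
  "hadprgd_run f x\<^sub>0 e p M \<xi> \<longleftrightarrow>
     prob_space M \<and>
     (\<forall>j. \<xi> j \<in> borel_measurable M) \<and>
     (\<forall>j. (\<lambda>\<omega>. hadprgd_path f x\<^sub>0 e p (\<lambda>i. \<xi> i \<omega>) j) \<in> M \<rightarrow>\<^sub>M count_space UNIV \<Otimes>\<^sub>M borel) \<and>
     (\<forall>j. let z = (\<lambda>\<omega>. snd (hadprgd_path f x\<^sub>0 e p (\<lambda>i. \<xi> i \<omega>) j)) in
        (\<forall>\<omega> \<in> space M. \<xi> j \<omega> \<in> tangent_space (z \<omega>) \<inter> cball 0 (noise_radius p)) \<and>
        (\<forall>A \<in> sets (Pi\<^sub>M {..<j} (\<lambda>_. borel)). \<forall>B \<in> sets borel.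
           emeasure M {\<omega> \<in> space M. (\<lambda>i\<in>{..<j}. \<xi> i \<omega>) \<in> A \<and> \<xi> j \<omega> \<in> B} =
           (\<integral>\<^sup>+ \<omega> \<in> {\<omega> \<in> space M. (\<lambda>i\<in>{..<j}. \<xi> i \<omega>) \<in> A}.
              emeasure (uniform_tangent_ball (z \<omega>) (noise_radius p)) B \<partial>M)))"

text \<open>
  The event that some \<open>z\<^sub>k\<close> with \<open>0 \<le> k \<le> K\<close> produced by the run satisfies \<open>P\<close>.
\<close>
definition visits_within ::
    "(real ^ 'n \<Rightarrow> real) \<Rightarrow> real ^ 'n \<Rightarrow> real \<Rightarrow> prgd_params \<Rightarrow> 'w measure \<Rightarrow> (nat \<Rightarrow> 'w \<Rightarrow> real ^ 'n) \<Rightarrow>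
     nat \<Rightarrow> (real ^ 'n \<Rightarrow> bool) \<Rightarrow> 'w set" where
  "visits_within f x\<^sub>0 e p M \<xi> K P =
     {\<omega> \<in> space M. \<exists>j k z. hadprgd_path f x\<^sub>0 e p (\<lambda>i. \<xi> i \<omega>) j = (k, z) \<and> k \<le> K \<and> P z}"

end

theory Submission
  imports Defs
begin

text \<open>
  On the sphere, the Riemannian Hessian of \<open>g z = f (z * z)\<close> has the quadratic form
  \<open>4 (z * v) \<bullet> H (z * v) + 2 \<beta> \<bullet> (v * v)\<close>, where \<open>H\<close> is the Hessian of \<open>f\<close> at \<open>z * z\<close> and \<open>\<beta>\<close> collects the
  multipliers. So a second-order stationary point \<open>z\<close> of \<open>g\<close> gives the second-order KKT point
  \<open>z * z\<close>, which under the hypotheses is a non-degenerate global minimizer, and then the Hessian of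
  \<open>g\<close> at \<open>z\<close> is positive definite. Hence near \<open>z\<close> the gradient of \<open>g\<close> grows at least linearly in the
  distance to \<open>z\<close> while \<open>g\<close> grows at most quadratically, so the objective gap is at most a constant
  times the squared gradient norm. By compactness of the sphere, every point that is second-order
  stationary up to a small tolerance \<open>e\<close> has gap at most \<open>C * e\<^sup>2\<close>, and running the algorithm with
  \<open>e = sqrt (\<epsilon> / C)\<close> turns the bound \<open>1 / e\<^sup>2\<close> on the iterations into \<open>1 / \<epsilon>\<close>.
\<close>

section \<open>Second derivatives and symmetric operators\<close>

lemma GDERIV_line:
  assumes "GDERIV f (p + s *\<^sub>R v) :> D"
  shows "DERIV (\<lambda>s. f (p + s *\<^sub>R v)) s :> D \<bullet> v"
proof -
  have "((\<lambda>s. p + s *\<^sub>R v) has_derivative (\<lambda>t. t *\<^sub>R v)) (at s)"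
    by (auto intro!: derivative_eq_intros)
  from has_derivative_compose[OF this assms[unfolded gderiv_def]]
  have "((\<lambda>s. f (p + s *\<^sub>R v)) has_derivative (\<lambda>t. (t *\<^sub>R v) \<bullet> D)) (at s)" .
  moreover have "(\<lambda>t. (t *\<^sub>R v) \<bullet> D) = (*) (D \<bullet> v)"
    by (auto simp: inner_commute)
  ultimately show ?thesis
    by (simp add: has_field_derivative_def)
qed

lemma GDERIV_unique:
  assumes "GDERIV f x :> D" "GDERIV f x :> D'"
  shows "D = D'"
proof -
  have "(\<lambda>h. h \<bullet> D) = (\<lambda>h. h \<bullet> D')"
    using assms has_derivative_unique unfolding gderiv_def by blast
  then have "\<forall>h. h \<bullet> D = h \<bullet> D'"
    by meson
  then show ?thesis
    by (simp only: vector_eq_ldot)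
qed

text \<open>Both mixed derivatives are limits of the same second difference quotient.\<close>
lemma second_derivative_symmetric:
  fixes f :: "'a::real_inner \<Rightarrow> real"
  assumes D: "\<And>y. GDERIV f y :> G y" and A: "(G has_derivative A) (at x)"
  shows "u \<bullet> A v = v \<bullet> A u"
proof (rule ccontr)
  define \<Delta> where
    "\<Delta> u v t = f (x + t *\<^sub>R u + t *\<^sub>R v) - f (x + t *\<^sub>R u) - f (x + t *\<^sub>R v) + f x" for u v t
  interpret bounded_linear A
    by (rule has_derivative_bounded_linear[OF A])
  \<comment> \<open>The mean value theorem in direction \<open>v\<close> alone pairs
    \<open>v\<close> with \<open>A u\<close>. Interchanging the two vectors gives the other pairing
    for the same second difference.\<close>
  have key: "\<exists>d>0. \<forall>t. 0 < t \<and> t < d \<longrightarrow> \<bar>\<Delta> u v t - t\<^sup>2 * (v \<bullet> A u)\<bar> \<le> t\<^sup>2 * (2 * e * (norm u + norm v)\<^sup>2)"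
    if e: "e > 0" for u v e
  proof -
    define c where "c = norm u + norm v"
    have c: "c \<ge> 0" "norm u \<le> c" "norm v \<le> c"
      by (auto simp: c_def)
    from A e obtain d where d: "d > 0"
      "\<And>y. norm (y - x) < d \<Longrightarrow> norm (G y - G x - A (y - x)) \<le> e * norm (y - x)"
      unfolding has_derivative_at_alt by blast
    \<comment> \<open>The bound on \<open>t\<close> keeps all displacements from \<open>x\<close>
      shorter than \<open>d\<close>; the \<open>+ 1\<close> guards against
      \<open>c = 0\<close>.\<close>
    have *: "\<bar>\<Delta> u v t - t\<^sup>2 * (v \<bullet> A u)\<bar> \<le> t\<^sup>2 * (2 * e * c\<^sup>2)" if t: "0 < t" "t < d / (c + 1)" for t
    proof -
      define h where "h s = f ((x + t *\<^sub>R u) + s *\<^sub>R v) - f (x + s *\<^sub>R v)" for s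
      have "DERIV h s :> G ((x + t *\<^sub>R u) + s *\<^sub>R v) \<bullet> v - G (x + s *\<^sub>R v) \<bullet> v" for s
        unfolding h_def by (intro DERIV_diff GDERIV_line D)
      from MVT2[OF t(1) this] obtain s where s: "0 < s" "s < t"
        and hs: "h t - h 0 = t * (G ((x + t *\<^sub>R u) + s *\<^sub>R v) \<bullet> v - G (x + s *\<^sub>R v) \<bullet> v)"
        by auto
      have tc: "t * c < d"
        using t c by (simp add: field_simps)
      have n1: "norm (t *\<^sub>R u + s *\<^sub>R v) \<le> t * c"
      proof -
        have "norm (t *\<^sub>R u + s *\<^sub>R v) \<le> t * norm u + s * norm v"
          by (rule norm_triangle_le) (use s t in simp)
        also have "\<dots> \<le> t * norm u + t * norm v"
          using s by (intro add_mono mult_right_mono) auto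
        finally show ?thesis
          by (simp add: c_def algebra_simps)
      qed
      have n2: "norm (s *\<^sub>R v) \<le> t * c"
        using s c by (simp add: mult_mono)
      \<comment> \<open>Both values of \<open>G\<close> are linearized about the fixed point
        \<open>x\<close>, since \<open>G\<close> is known to be differentiable only there.\<close>
      define r where "r w = G (x + w) - G x - A w" for w
      have r: "norm (r w) \<le> e * (t * c)" if "norm w \<le> t * c" for w
      proof -
        have "norm (r w) \<le> e * norm w"
          using d(2)[of "x + w"] that tc by (simp add: r_def)
        also have "\<dots> \<le> e * (t * c)"
          using that e by simp
        finally show ?thesis .
      qed
      have "\<Delta> u v t = h t - h 0"
        by (simp add: \<Delta>_def h_def)
      also have "\<dots> = t * ((A (t *\<^sub>R u + s *\<^sub>R v) - A (s *\<^sub>R v) + (r (t *\<^sub>R u + s *\<^sub>R v) - r (s *\<^sub>R v))) \<bullet> v)"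
        by (simp add: hs r_def add.assoc inner_diff_left inner_add_left)
      also have "\<dots> = t\<^sup>2 * (v \<bullet> A u) + t * ((r (t *\<^sub>R u + s *\<^sub>R v) - r (s *\<^sub>R v)) \<bullet> v)"
        by (simp add: add scaleR inner_add_left algebra_simps power2_eq_square inner_commute)
      finally have "\<bar>\<Delta> u v t - t\<^sup>2 * (v \<bullet> A u)\<bar> = t * \<bar>(r (t *\<^sub>R u + s *\<^sub>R v) - r (s *\<^sub>R v)) \<bullet> v\<bar>"
        using t by (simp add: abs_mult)
      also have "\<dots> \<le> t * (norm (r (t *\<^sub>R u + s *\<^sub>R v) - r (s *\<^sub>R v)) * norm v)"
        using t by (intro mult_left_mono Cauchy_Schwarz_ineq2) auto
      also have "\<dots> \<le> t * ((e * (t * c) + e * (t * c)) * c)"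
        using t c e by (intro mult_left_mono mult_mono norm_triangle_le_diff add_mono r n1 n2) auto
      finally show ?thesis
        by (simp add: power2_eq_square algebra_simps)
    qed
    show ?thesis
      by (rule exI[of _ "d / (c + 1)"]) (use * d c in \<open>auto simp: c_def[symmetric]\<close>)
  qed
  assume "u \<bullet> A v \<noteq> v \<bullet> A u"
  define q where "q = \<bar>v \<bullet> A u - u \<bullet> A v\<bar>"
  define c where "c = norm u + norm v"
  have q: "q > 0"
    using \<open>u \<bullet> A v \<noteq> v \<bullet> A u\<close> by (simp add: q_def)
  \<comment> \<open>The two errors then add up to \<open>4 * c\<^sup>2 * e\<close> per
    \<open>t\<^sup>2\<close>, which is \<open>q - e\<close> and so falls short of
    \<open>q\<close>.\<close>
  define e where "e = q / (4 * c\<^sup>2 + 1)"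
  have c4: "4 * c\<^sup>2 + 1 > 0"
    by (simp add: add_nonneg_pos)
  have e: "e > 0" using q c4 by (simp add: e_def)
  from key[OF e, of u v] key[OF e, of v u] obtain d1 d2 where d: "d1 > 0" "d2 > 0"
    "\<And>t. 0 < t \<Longrightarrow> t < d1 \<Longrightarrow> \<bar>\<Delta> u v t - t\<^sup>2 * (v \<bullet> A u)\<bar> \<le> t\<^sup>2 * (2 * e * c\<^sup>2)"
    "\<And>t. 0 < t \<Longrightarrow> t < d2 \<Longrightarrow> \<bar>\<Delta> v u t - t\<^sup>2 * (u \<bullet> A v)\<bar> \<le> t\<^sup>2 * (2 * e * c\<^sup>2)"
    by (auto simp: c_def add.commute)
  define t where "t = min d1 d2 / 2"
  have t: "0 < t" "t < d1" "t < d2"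
    using d by (auto simp: t_def)
  have "\<Delta> u v t = \<Delta> v u t"
    by (simp add: \<Delta>_def algebra_simps)
  then have "\<bar>t\<^sup>2 * (v \<bullet> A u) - t\<^sup>2 * (u \<bullet> A v)\<bar> \<le> t\<^sup>2 * (2 * e * c\<^sup>2) + t\<^sup>2 * (2 * e * c\<^sup>2)"
    using d(3)[OF t(1,2)] d(4)[OF t(1,3)] by linarith
  moreover have "\<bar>t\<^sup>2 * (v \<bullet> A u) - t\<^sup>2 * (u \<bullet> A v)\<bar> = t\<^sup>2 * q"
    by (simp add: q_def abs_mult flip: right_diff_distrib)
  ultimately have "t\<^sup>2 * q \<le> t\<^sup>2 * (4 * c\<^sup>2 * e)"
    by (simp add: algebra_simps)
  then have "q \<le> 4 * c\<^sup>2 * e"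
    by (rule mult_left_le_imp_le) (use t in simp)
  moreover have "e * (4 * c\<^sup>2 + 1) = q"
    using c4 by (simp add: e_def)
  ultimately show False
    using e by (simp add: algebra_simps)
qed

text \<open>Near \<open>t = 0\<close> the linear term dominates, so a nonzero \<open>a\<close> would
  make the expression negative on one side of \<open>0\<close>.\<close>

lemma linear_coeff_eq_zero:
  fixes a b :: real
  assumes "\<And>t. 0 \<le> t * a + t\<^sup>2 * b"
  shows "a = 0"
proof (rule ccontr)
  assume "a \<noteq> 0"
  define B where "B = \<bar>b\<bar> + 1"
  have B: "B > 0" "b < B" by (auto simp: B_def)
  have "0 \<le> (- a / B) * a + (- a / B)\<^sup>2 * b"
    by (rule assms)
  also have "\<dots> = a\<^sup>2 / B\<^sup>2 * (b - B)"
    using B by (simp add: field_simps power2_eq_square)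
  also have "\<dots> < 0"
    using B \<open>a \<noteq> 0\<close> by (intro mult_pos_neg) auto
  finally show False by simp
qed

text \<open>The quadratic form attains its minimum on the compact unit sphere of \<open>T\<close>,
  and stationarity of that minimum along every line in \<open>T\<close> makes the minimizer an
  eigenvector.\<close>

lemma min_eigenvalue_on_subspace:
  fixes H :: "'a::euclidean_space \<Rightarrow> 'a"
  assumes T: "subspace T" and H: "bounded_linear H" and maps: "\<And>v. v \<in> T \<Longrightarrow> H v \<in> T"
    and sym: "\<And>u v. u \<in> T \<Longrightarrow> v \<in> T \<Longrightarrow> u \<bullet> H v = v \<bullet> H u"
    and nz: "v0 \<in> T" "v0 \<noteq> 0"
  obtains \<mu> w where "w \<in> T" "w \<noteq> 0" "H w = \<mu> *\<^sub>R w" "\<And>y. y \<in> T \<Longrightarrow> \<mu> * (norm y)\<^sup>2 \<le> y \<bullet> H y"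
proof -
  interpret bounded_linear H by (rule H)
  have "compact (T \<inter> sphere 0 1)"
    using closed_subspace[OF T] by (simp add: closed_Int_compact)
  moreover have "sgn v0 \<in> T \<inter> sphere 0 1"
    using nz T by (simp add: sgn_div_norm subspace_scale)
  moreover have "continuous_on (T \<inter> sphere 0 1) (\<lambda>v. v \<bullet> H v)"
    by (intro continuous_intros linear_continuous_on H)
  ultimately obtain w where w: "w \<in> T" "norm w = 1"
    and wmin: "\<And>y. y \<in> T \<Longrightarrow> norm y = 1 \<Longrightarrow> w \<bullet> H w \<le> y \<bullet> H y"
    by (metis (no_types, lifting) IntD1 IntD2 IntI continuous_attains_inf empty_iff mem_sphere_0)
  define \<mu> where "\<mu> = w \<bullet> H w"
  have min: "\<mu> * (norm y)\<^sup>2 \<le> y \<bullet> H y" if y: "y \<in> T" for y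
  proof (cases "y = 0")
    case False
    have "\<mu> \<le> sgn y \<bullet> H (sgn y)"
      unfolding \<mu>_def using False y T by (intro wmin) (auto simp: norm_sgn sgn_div_norm subspace_scale)
    also have "\<dots> = (y \<bullet> H y) / (norm y)\<^sup>2"
      by (simp add: sgn_div_norm scaleR power2_eq_square divide_simps)
    finally show ?thesis
      using False by (simp add: field_simps)
  qed (simp add: zero)
  have "(H w - \<mu> *\<^sub>R w) \<bullet> y = 0" if y: "y \<in> T" for y
  proof -
    \<comment> \<open>This is \<open>min\<close> at \<open>w + t *\<^sub>R y\<close> with both sides
      expanded; the constant terms cancel because \<open>w\<close> attains the minimum.\<close>
    have "0 \<le> t * (2 * ((H w - \<mu> *\<^sub>R w) \<bullet> y)) + t\<^sup>2 * (y \<bullet> H y - \<mu> * (y \<bullet> y))" for t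
    proof -
      have "w + t *\<^sub>R y \<in> T"
        using T w y by (simp add: subspace_add subspace_scale)
      from min[OF this] have "\<mu> * ((w + t *\<^sub>R y) \<bullet> (w + t *\<^sub>R y)) \<le> (w + t *\<^sub>R y) \<bullet> H (w + t *\<^sub>R y)"
        by (simp add: power2_norm_eq_inner)
      moreover have "w \<bullet> w = 1" "y \<bullet> H w = w \<bullet> H y" "H w \<bullet> y = w \<bullet> H y" "y \<bullet> w = w \<bullet> y"
        using sym[OF y w(1)] w(2) by (simp_all add: norm_eq_1 inner_commute)
      moreover have "w \<bullet> H w = \<mu>"
        by (simp add: \<mu>_def)
      ultimately show ?thesis
        by (simp add: add scaleR inner_add_left inner_add_right inner_diff_left
            algebra_simps power2_eq_square)
    qed
    from linear_coeff_eq_zero[OF this] show ?thesis by simp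
  qed
  \<comment> \<open>The residual lies in \<open>T\<close> itself, so it is orthogonal to
    itself.\<close>
  from this[of "H w - \<mu> *\<^sub>R w"] have "H w = \<mu> *\<^sub>R w"
    using w maps T by (simp add: subspace_diff subspace_scale)
  with min w show ?thesis
    by (intro that[of w \<mu>]) auto
qed

section \<open>The Riemannian gradient and Hessian of a smooth function on the sphere\<close>

lemma subspace_tangent_space: "subspace (tangent_space z)"
  by (auto simp: subspace_def tangent_space_def inner_add_left)

lemma linear_tangent_proj: "linear (tangent_proj z)"
  by (rule linearI) (auto simp: tangent_proj_def inner_add_left algebra_simps)

lemma tangent_proj_in_tangent_space:
  assumes "norm z = 1"
  shows "tangent_proj z w \<in> tangent_space z"
  using assms by (simp add: tangent_proj_def tangent_space_def inner_diff_left norm_eq_1)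

lemma inner_tangent_proj:
  assumes "v \<in> tangent_space z"
  shows "v \<bullet> tangent_proj z w = v \<bullet> w"
  using assms by (simp add: tangent_proj_def tangent_space_def inner_diff_right)

text \<open>By the parity of \<open>cos\<close> and \<open>sin\<close>, \<open>\<bar>t\<bar>\<close>
  may be replaced by \<open>t\<close>, which makes the geodesic visibly differentiable at
  \<open>t = 0\<close>.\<close>

lemma sphere_exp_scaleR:
  "sphere_exp z (t *\<^sub>R v) = cos (t * norm v) *\<^sub>R z + sin (t * norm v) *\<^sub>R sgn v"
proof -
  have "\<bar>t\<bar> = t \<or> \<bar>t\<bar> = - t" by linarith
  then show ?thesis
    by (auto simp: sphere_exp_def sgn_scaleR sgn_real_def abs_if)
qed

lemma sphere_exp_in_sphere:
  assumes "norm z = 1" "v \<in> tangent_space z"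
  shows "sphere_exp z v \<in> sphere 0 1"
proof (cases "v = 0")
  case False
  have "z \<bullet> z = 1" "sgn v \<bullet> sgn v = 1" "z \<bullet> sgn v = 0"
    using assms False norm_sgn[of v] norm_eq_1[of "sgn v"]
    by (simp_all add: norm_eq_1 tangent_space_def sgn_div_norm inner_commute)
  then have "sphere_exp z v \<bullet> sphere_exp z v = 1"
    by (simp add: sphere_exp_def inner_add_left inner_add_right inner_commute
        flip: power2_eq_square)
  then show ?thesis
    by (simp add: norm_eq_1)
qed (use assms in \<open>simp add: sphere_exp_def\<close>)

lemma has_vector_derivative_sphere_exp:
  "((\<lambda>t. sphere_exp z (t *\<^sub>R v)) has_vector_derivative v) (at 0)"
proof -
  have "((\<lambda>t. cos (t * norm v) *\<^sub>R z + sin (t * norm v) *\<^sub>R sgn v) has_vector_derivative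
      norm v *\<^sub>R sgn v) (at 0)"
    by (auto intro!: derivative_eq_intros)
  moreover have "norm v *\<^sub>R sgn v = v"
    by (cases "v = 0") (simp_all add: sgn_div_norm)
  ultimately show ?thesis
    by (simp add: sphere_exp_scaleR)
qed

text \<open>A chord of the sphere is tangent up to an error of second order in its length. This is
  what makes the Euclidean estimates near a critical point work.\<close>

lemma inner_chord:
  fixes y z :: "'a::real_inner"
  assumes "norm y = 1" "norm z = 1"
  shows "(y - z) \<bullet> z = - ((norm (y - z))\<^sup>2 / 2)"
proof -
  have "(norm (y - z))\<^sup>2 = 2 - 2 * (y \<bullet> z)"
    using assms by (simp add: power2_norm_eq_inner norm_eq_1 inner_diff_left inner_diff_right inner_commute)
  moreover have "(y - z) \<bullet> z = y \<bullet> z - 1"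
    using assms by (simp add: norm_eq_1 inner_diff_left)
  ultimately show ?thesis by linarith
qed

lemma riem_grad_eq:
  fixes z :: "real ^ 'n"
  assumes g: "GDERIV g z :> D" and z: "norm z = 1"
  shows "riem_grad g z = tangent_proj z D"
  unfolding riem_grad_def gradient_on_def
proof (rule the_equality)
  define P where "P = tangent_proj z D"
  have P: "P \<in> tangent_space z"
    unfolding P_def by (rule tangent_proj_in_tangent_space[OF z])
  text \<open>The correction term vanishes on the sphere and removes the normal part of the gradient.\<close>
  have "((\<lambda>y. g y - (D \<bullet> z) * ((y \<bullet> y - 1) / 2)) has_derivative (\<lambda>h. P \<bullet> h)) (at z)"
    by (auto intro!: derivative_eq_intros g[unfolded gderiv_def]
        simp: P_def tangent_proj_def fun_eq_iff inner_diff_left inner_commute algebra_simps)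
  from has_derivative_at_withinI[OF this, of "sphere 0 1"]
  have der: "(g has_derivative (\<lambda>h. P \<bullet> h)) (at z within sphere 0 1)"
    by (rule has_derivative_transform[rotated 2]) (use z in \<open>auto simp: norm_eq_1\<close>)
  then show "tangent_proj z D \<in> tangent_space z \<and>
      (g has_derivative (\<lambda>v. tangent_proj z D \<bullet> v)) (at z within sphere 0 1)"
    using P by (simp add: P_def)
  fix w
  assume w: "w \<in> tangent_space z \<and> (g has_derivative (\<lambda>v. w \<bullet> v)) (at z within sphere 0 1)"
  \<comment> \<open>A derivative within the sphere determines nothing in the normal direction. Two
    tangent candidates differ by a tangent vector, and the geodesic with that velocity separates
    them.\<close>
  define u where "u = w - P"
  have u: "u \<in> tangent_space z"
    unfolding u_def using w P by (intro subspace_diff[OF subspace_tangent_space]) auto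
  define c where "c t = sphere_exp z (t *\<^sub>R u)" for t
  have c: "(c has_derivative (\<lambda>t. t *\<^sub>R u)) (at 0)"
    using has_vector_derivative_sphere_exp[of z u] by (simp add: has_vector_derivative_def c_def[abs_def])
  have c0: "c 0 = z"
    by (simp add: c_def sphere_exp_def)
  have "c t \<in> sphere 0 1" for t
    unfolding c_def using u by (intro sphere_exp_in_sphere z subspace_scale[OF subspace_tangent_space])
  then have range: "range c \<subseteq> sphere 0 1" by blast
  have "((\<lambda>t. g (c t)) has_derivative (\<lambda>t. d \<bullet> (t *\<^sub>R u))) (at 0)"
    if "(g has_derivative (\<lambda>v. d \<bullet> v)) (at z within sphere 0 1)" for d
    by (rule has_derivative_in_compose[OF c]) (use has_derivative_subset[OF that range] in \<open>simp add: c0\<close>)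
  from has_derivative_unique[OF this[OF der] this[OF conjunct2[OF w]]]
  have "P \<bullet> u = w \<bullet> u"
    by (metis scaleR_one)
  then have "u \<bullet> u = 0"
    by (simp add: u_def inner_diff_left)
  then show "w = tangent_proj z D"
    by (simp add: u_def P_def)
qed

text \<open>Ambient data on the whole space: the Euclidean gradient \<open>G\<close> and Hessian
  \<open>H\<close>. All Riemannian quantities on the sphere are computed from them.\<close>

locale twice_differentiable_function =
  fixes g :: "real ^ 'n \<Rightarrow> real" and G :: "real ^ 'n \<Rightarrow> real ^ 'n"
    and H :: "real ^ 'n \<Rightarrow> real ^ 'n \<Rightarrow> real ^ 'n"
  assumes gderiv: "GDERIV g z :> G z"
    and has_derivative_gradient: "(G has_derivative H z) (at z)"
begin

sublocale H: bounded_linear "H z" for z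
  by (rule has_derivative_bounded_linear[OF has_derivative_gradient])

lemma hessian_symmetric: "u \<bullet> H z v = v \<bullet> H z u"
  by (rule second_derivative_symmetric[OF gderiv has_derivative_gradient])

lemma riem_grad_sphere: "norm z = 1 \<Longrightarrow> riem_grad g z = tangent_proj z (G z)"
  by (rule riem_grad_eq[OF gderiv])

text \<open>The derivative of \<open>tangent_proj y (G y)\<close>, a field on the whole space that
  extends the Riemannian gradient from the sphere.\<close>

definition projected_gradient_derivative where
  "projected_gradient_derivative z h = H z h - (H z h \<bullet> z + G z \<bullet> h) *\<^sub>R z - (G z \<bullet> z) *\<^sub>R h"

lemma has_derivative_projected_gradient:
  "((\<lambda>y. tangent_proj y (G y)) has_derivative projected_gradient_derivative z) (at z)"
  unfolding tangent_proj_def projected_gradient_derivative_def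
  by (auto intro!: derivative_eq_intros has_derivative_gradient simp: fun_eq_iff algebra_simps)

text \<open>Along a geodesic the Riemannian gradient is the projected Euclidean gradient, so the
  chain rule applies. The final projection removes the multiples of \<open>z\<close>, and
  \<open>(G z \<bullet> z) *\<^sub>R v\<close> is the curvature correction of the sphere.\<close>

lemma riem_hess_eq:
  assumes z: "norm z = 1" and v: "v \<in> tangent_space z"
  shows "riem_hess g z v = tangent_proj z (H z v) - (G z \<bullet> z) *\<^sub>R v"
proof -
  define c where "c t = sphere_exp z (t *\<^sub>R v)" for t
  have c: "(c has_derivative (\<lambda>t. t *\<^sub>R v)) (at 0)"
    using has_vector_derivative_sphere_exp[of z v] by (simp add: has_vector_derivative_def c_def[abs_def])
  have c0: "c 0 = z"
    by (simp add: c_def sphere_exp_def)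
  have "c t \<in> sphere 0 1" for t
    unfolding c_def using v by (intro sphere_exp_in_sphere z subspace_scale[OF subspace_tangent_space])
  then have eq: "riem_grad g (c t) = tangent_proj (c t) (G (c t))" for t
    by (simp add: riem_grad_sphere)
  interpret L: bounded_linear "projected_gradient_derivative z"
    by (rule has_derivative_bounded_linear[OF has_derivative_projected_gradient])
  have "((\<lambda>t. riem_grad g (c t)) has_derivative (\<lambda>t. projected_gradient_derivative z (t *\<^sub>R v))) (at 0)"
    unfolding eq by (rule has_derivative_compose[OF c])
      (use has_derivative_projected_gradient[of z] in \<open>simp add: c0\<close>)
  then have "((\<lambda>t. riem_grad g (c t)) has_vector_derivative projected_gradient_derivative z v) (at 0)"
    by (simp add: has_vector_derivative_def L.scaleR)
  then have "riem_hess g z v = tangent_proj z (projected_gradient_derivative z v)"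
    unfolding riem_hess_def c_def[symmetric] by (simp add: vector_derivative_at)
  also have "\<dots> = tangent_proj z (H z v) - (G z \<bullet> z) *\<^sub>R v"
    using v z by (simp add: projected_gradient_derivative_def tangent_proj_def tangent_space_def
        inner_diff_left inner_add_left norm_eq_1 algebra_simps)
  finally show ?thesis .
qed

text \<open>The Riemannian Hessian is self-adjoint on the tangent space, because \<open>H z\<close>
  is symmetric and the projection disappears when paired with tangent vectors. The vector
  \<open>v0\<close> rules out the trivial tangent space of dimension one.\<close>

lemma riem_hess_min_eigenvalue:
  assumes z: "norm z = 1" and nz: "v0 \<in> tangent_space z" "v0 \<noteq> 0"
  obtains \<mu> w where "w \<in> tangent_space z" "w \<noteq> 0" "riem_hess g z w = \<mu> *\<^sub>R w"
    "w \<bullet> H z w - (G z \<bullet> z) * (norm w)\<^sup>2 = \<mu> * (norm w)\<^sup>2"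
    "\<And>v. v \<in> tangent_space z \<Longrightarrow> \<mu> * (norm v)\<^sup>2 \<le> v \<bullet> H z v - (G z \<bullet> z) * (norm v)\<^sup>2"
proof -
  define A where "A v = tangent_proj z (H z v) - (G z \<bullet> z) *\<^sub>R v" for v
  have inner_A: "u \<bullet> A v = u \<bullet> H z v - (G z \<bullet> z) * (u \<bullet> v)" if "u \<in> tangent_space z" for u v
    using that by (simp add: A_def inner_diff_right inner_tangent_proj)
  have "linear A"
    unfolding A_def
    by (intro linear_compose_sub linear_compose_scale_right linear_ident
        linear_compose[OF H.linear linear_tangent_proj, unfolded o_def])
  then have bl: "bounded_linear A"
    by (rule linear_conv_bounded_linear[THEN iffD1])
  have maps: "A v \<in> tangent_space z" if "v \<in> tangent_space z" for v
    unfolding A_def using that z subspace_tangent_space[of z]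
    by (intro subspace_diff subspace_scale tangent_proj_in_tangent_space)
  have sym: "u \<bullet> A v = v \<bullet> A u" if "u \<in> tangent_space z" "v \<in> tangent_space z" for u v
    using that by (simp add: inner_A inner_commute hessian_symmetric[of u])
  obtain \<mu> w where w: "w \<in> tangent_space z" "w \<noteq> 0" "A w = \<mu> *\<^sub>R w"
    and min: "\<And>y. y \<in> tangent_space z \<Longrightarrow> \<mu> * (norm y)\<^sup>2 \<le> y \<bullet> A y"
    using min_eigenvalue_on_subspace[OF subspace_tangent_space bl maps sym nz] by blast
  show ?thesis
  proof (rule that)
    show "riem_hess g z w = \<mu> *\<^sub>R w"
      using w riem_hess_eq[OF z w(1)] by (simp add: A_def)
    show "w \<bullet> H z w - (G z \<bullet> z) * (norm w)\<^sup>2 = \<mu> * (norm w)\<^sup>2"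
      using inner_A[OF w(1), of w] w(3) by (simp add: power2_norm_eq_inner)
    show "\<mu> * (norm v)\<^sup>2 \<le> v \<bullet> H z v - (G z \<bullet> z) * (norm v)\<^sup>2" if "v \<in> tangent_space z" for v
      using min[OF that] inner_A[OF that, of v] by (simp add: power2_norm_eq_inner)
  qed (use w in auto)
qed

text \<open>The least value of the form on unit tangent vectors is an eigenvalue, hence at least the
  infimum. For \<open>v = 0\<close> both sides vanish, which covers dimension one, where the infimum
  is infinite.\<close>

lemma riem_hess_lambda_min_le_quotient:
  assumes z: "norm z = 1" and v: "v \<in> tangent_space z"
    and lam: "ereal c \<le> riem_hess_lambda_min g z"
  shows "c * (norm v)\<^sup>2 \<le> v \<bullet> H z v - (G z \<bullet> z) * (norm v)\<^sup>2"
proof (cases "v = 0")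
  case False
  obtain \<mu> w where w: "w \<in> tangent_space z" "w \<noteq> 0" "riem_hess g z w = \<mu> *\<^sub>R w"
    and min: "\<And>v. v \<in> tangent_space z \<Longrightarrow> \<mu> * (norm v)\<^sup>2 \<le> v \<bullet> H z v - (G z \<bullet> z) * (norm v)\<^sup>2"
    using riem_hess_min_eigenvalue[OF z v False] by blast
  have "riem_hess_lambda_min g z \<le> ereal \<mu>"
    unfolding riem_hess_lambda_min_def by (rule INF_lower) (use w in blast)
  with lam have "c \<le> \<mu>"
    by (metis ereal_less_eq(3) order_trans)
  then have "c * (norm v)\<^sup>2 \<le> \<mu> * (norm v)\<^sup>2"
    by (rule mult_right_mono) simp
  with min[OF v] show ?thesis by linarith
qed (simp add: H.zero)

section \<open>Growth of the function and of its gradient near a critical point\<close>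

text \<open>At a critical point \<open>G z\<close> is a multiple of \<open>z\<close>, so the
  first-order term along a chord is of second order by \<open>inner_chord\<close>. The local
  Lipschitz bound on the gradient controls the rest.\<close>

lemma local_quadratic_upper_bound:
  assumes z: "norm z = 1" and crit: "tangent_proj z (G z) = 0"
  obtains C d where "C > 0" "d > 0"
    "\<And>y. norm y = 1 \<Longrightarrow> norm (y - z) < d \<Longrightarrow> g y - g z \<le> C * (norm (y - z))\<^sup>2"
proof -
  obtain B where B: "B > 0" "\<And>h. norm (H z h) \<le> norm h * B"
    using H.pos_bounded by blast
  obtain d where d: "d > 0"
    "\<And>y. norm (y - z) < d \<Longrightarrow> norm (G y - G z - H z (y - z)) \<le> 1 * norm (y - z)"
    using has_derivative_gradient[of z] unfolding has_derivative_at_alt by (metis zero_less_one)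
  have lip: "norm (G y - G z) \<le> (B + 1) * norm (y - z)" if "norm (y - z) < d" for y
    using d(2)[OF that] B(2)[of "y - z"] norm_triangle_sub[of "G y - G z" "H z (y - z)"]
    by (simp add: algebra_simps)
  define l where "l = G z \<bullet> z"
  have Gz: "G z = l *\<^sub>R z"
    using crit by (simp add: tangent_proj_def l_def)
  have "g y - g z \<le> (\<bar>l\<bar> + (B + 1)) * (norm (y - z))\<^sup>2" if y: "norm y = 1" "norm (y - z) < d" for y
  proof -
    define h where "h = y - z"
    \<comment> \<open>The segment from \<open>z\<close> to \<open>y\<close> leaves the sphere, but
      \<open>g\<close> is differentiable on the whole space.\<close>
    have "DERIV (\<lambda>s. g (z + s *\<^sub>R h)) s :> G (z + s *\<^sub>R h) \<bullet> h" for s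
      by (intro GDERIV_line gderiv)
    from MVT2[OF zero_less_one this] obtain s where s: "0 < s" "s < 1"
      and eq: "g y - g z = G (z + s *\<^sub>R h) \<bullet> h"
      by (auto simp: h_def)
    have zh: "z \<bullet> h = - ((norm h)\<^sup>2 / 2)"
      using inner_chord[OF y(1) z] by (simp add: h_def inner_commute)
    have sh: "norm (s *\<^sub>R h) \<le> norm h"
      using s by (simp add: mult_left_le_one_le)
    have "(G (z + s *\<^sub>R h) - G z) \<bullet> h \<le> norm (G (z + s *\<^sub>R h) - G z) * norm h"
      by (rule norm_cauchy_schwarz)
    also have "\<dots> \<le> ((B + 1) * norm (s *\<^sub>R h)) * norm h"
      using lip[of "z + s *\<^sub>R h"] sh y(2) by (intro mult_right_mono) (auto simp: h_def)
    also have "\<dots> \<le> ((B + 1) * norm h) * norm h"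
      using B sh by (intro mult_right_mono mult_left_mono) auto
    finally have "g y - g z \<le> l * (z \<bullet> h) + (B + 1) * (norm h)\<^sup>2"
      by (simp add: eq inner_diff_left Gz power2_eq_square algebra_simps)
    also have "l * (z \<bullet> h) \<le> \<bar>l\<bar> * (norm h)\<^sup>2"
    proof -
      have "- l / 2 \<le> \<bar>l\<bar>" by linarith
      then have "(- l / 2) * (norm h)\<^sup>2 \<le> \<bar>l\<bar> * (norm h)\<^sup>2"
        by (rule mult_right_mono) simp
      then show ?thesis by (simp add: zh)
    qed
    finally show ?thesis
      by (simp add: h_def algebra_simps)
  qed
  then show ?thesis
    using B d(1) by (intro that[of "\<bar>l\<bar> + (B + 1)" d]) auto
qed

text \<open>The gradient field vanishes at \<open>z\<close>, and its derivative there is bounded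
  below on tangent vectors. A chord is tangent up to second order, so the gradient grows at least
  linearly in the distance.\<close>

lemma local_error_bound:
  assumes z: "norm z = 1" and crit: "tangent_proj z (G z) = 0"
    and pos: "\<And>v. v \<in> tangent_space z \<Longrightarrow> v \<noteq> 0 \<Longrightarrow> v \<bullet> H z v - (G z \<bullet> z) * (norm v)\<^sup>2 > 0"
  obtains c d where "c > 0" "d > 0"
    "\<And>y. norm y = 1 \<Longrightarrow> norm (y - z) < d \<Longrightarrow> c * norm (y - z) \<le> norm (riem_grad g y)"
proof -
  obtain \<mu> where \<mu>: "\<mu> > 0"
    and coercive: "\<And>v. v \<in> tangent_space z \<Longrightarrow> \<mu> * (norm v)\<^sup>2 \<le> v \<bullet> H z v - (G z \<bullet> z) * (norm v)\<^sup>2"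
  proof (cases "tangent_space z = {0}")
    case True
    then show ?thesis
      \<comment> \<open>Every positive constant is coercive on the zero space.\<close>
      by (intro that[of 1]) (auto simp: H.zero)
  next
    case False
    then obtain v0 where "v0 \<in> tangent_space z" "v0 \<noteq> 0"
      using subspace_0[OF subspace_tangent_space] by blast
    from riem_hess_min_eigenvalue[OF z this] obtain \<mu> w where
      w: "w \<in> tangent_space z" "w \<noteq> 0" "w \<bullet> H z w - (G z \<bullet> z) * (norm w)\<^sup>2 = \<mu> * (norm w)\<^sup>2"
      and min: "\<And>v. v \<in> tangent_space z \<Longrightarrow> \<mu> * (norm v)\<^sup>2 \<le> v \<bullet> H z v - (G z \<bullet> z) * (norm v)\<^sup>2"
      by metis
    have "\<mu> * (norm w)\<^sup>2 > 0"
      using pos[OF w(1,2)] w(3) by simp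
    then have "\<mu> > 0"
      using w(2) by (simp add: zero_less_mult_iff)
    with min show ?thesis by (intro that)
  qed
  define L where "L = projected_gradient_derivative z"
  define K where "K = norm (H z z)"
  have K: "K \<ge> 0" by (simp add: K_def)
  obtain d where d: "d > 0"
    "\<And>y. norm (y - z) < d \<Longrightarrow>
      norm (tangent_proj y (G y) - tangent_proj z (G z) - L (y - z)) \<le> \<mu> / 4 * norm (y - z)"
    using has_derivative_projected_gradient[of z] \<mu> unfolding has_derivative_at_alt L_def
    by (metis divide_pos_pos zero_less_numeral)
  \<comment> \<open>Pairing \<open>L h\<close> with the tangential part \<open>v\<close> of
    \<open>h\<close> brings in coercivity. The normal part of \<open>h\<close> has length
    \<open>(norm h)\<^sup>2 / 2\<close> and causes the quadratic loss.\<close>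
  have L: "\<mu> * norm h - (norm h)\<^sup>2 * ((\<mu> + K) / 2) \<le> norm (L h)"
    if y: "norm y = 1" and h_eq: "h = y - z" for y h
  proof -
    define v where "v = tangent_proj z h"
    have v: "v \<in> tangent_space z"
      unfolding v_def by (rule tangent_proj_in_tangent_space[OF z])
    have hz: "h \<bullet> z = - ((norm h)\<^sup>2 / 2)"
      using inner_chord[OF y z] by (simp add: h_eq)
    have h: "h = v + (h \<bullet> z) *\<^sub>R z"
      by (simp add: v_def tangent_proj_def)
    have vz: "v \<bullet> z = 0" using v by (simp add: tangent_space_def)
    then have vh: "v \<bullet> h = (norm v)\<^sup>2"
      by (subst h) (simp add: inner_add_right power2_norm_eq_inner)
    have nv: "norm h - (norm h)\<^sup>2 / 2 \<le> norm v"
      using norm_triangle_ineq[of v "(h \<bullet> z) *\<^sub>R z"] z h by (simp add: hz)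
    have Hh: "H z h = H z v + (h \<bullet> z) *\<^sub>R H z z"
      by (subst h) (simp only: H.add H.scaleR)
    have "v \<bullet> L h = v \<bullet> H z v + (h \<bullet> z) * (v \<bullet> H z z) - (G z \<bullet> z) * (norm v)\<^sup>2"
      by (simp add: L_def projected_gradient_derivative_def inner_diff_right inner_add_right vz vh Hh)
    moreover have "- ((norm h)\<^sup>2 / 2 * (norm v * K)) \<le> (h \<bullet> z) * (v \<bullet> H z z)"
      using norm_cauchy_schwarz[of v "H z z"] by (simp add: hz K_def mult_left_mono)
    ultimately have "\<mu> * (norm v)\<^sup>2 - (norm h)\<^sup>2 / 2 * (norm v * K) \<le> v \<bullet> L h"
      using coercive[OF v] by linarith
    also have "\<dots> \<le> norm v * norm (L h)"
      by (rule norm_cauchy_schwarz)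
    finally have "norm v * (\<mu> * norm v - (norm h)\<^sup>2 / 2 * K) \<le> norm v * norm (L h)"
      by (simp add: algebra_simps power2_eq_square)
    \<comment> \<open>Cancelling \<open>norm v\<close> requires \<open>v \<noteq> 0\<close>;
      otherwise the left-hand side is not positive.\<close>
    then have "\<mu> * norm v - (norm h)\<^sup>2 / 2 * K \<le> norm (L h)"
    proof (cases "v = 0")
      case True
      have "0 \<le> (norm h)\<^sup>2 * K" using K by simp
      then show ?thesis using True by (simp add: order_trans[OF _ norm_ge_zero])
    qed simp
    moreover have "\<mu> * (norm h - (norm h)\<^sup>2 / 2) \<le> \<mu> * norm v"
      using nv \<mu> by simp
    ultimately show ?thesis
      by (simp add: algebra_simps add_divide_distrib)
  qed
  \<comment> \<open>Within this radius the quadratic loss is at most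
    \<open>\<mu> / 4 * norm h\<close>. The linearization error is no larger, so half of
    \<open>\<mu>\<close> survives.\<close>
  define d' where "d' = min d (\<mu> / (2 * (\<mu> + K)))"
  show ?thesis
  proof (rule that[of "\<mu> / 2" d'])
    show "\<mu> / 2 > 0" "d' > 0"
      using \<mu> K d by (auto simp: d'_def)
    fix y :: "real ^ 'n"
    assume y: "norm y = 1" and yd: "norm (y - z) < d'"
    define h where "h = y - z"
    have hd: "norm h < d" "norm h \<le> \<mu> / (2 * (\<mu> + K))"
      using yd by (auto simp: d'_def h_def)
    have "norm h * ((\<mu> + K) / 2) \<le> \<mu> / 4"
      using hd(2) \<mu> K by (simp add: field_simps)
    from mult_left_mono[OF this norm_ge_zero[of h]]
    have "(norm h)\<^sup>2 * ((\<mu> + K) / 2) \<le> norm h * (\<mu> / 4)"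
      by (simp add: power2_eq_square)
    moreover have "norm (L h - tangent_proj y (G y)) \<le> norm h * (\<mu> / 4)"
      using d(2)[of y] hd by (simp add: h_def crit norm_minus_commute mult.commute)
    ultimately have "\<mu> * norm h - norm h * (\<mu> / 4) - norm h * (\<mu> / 4) \<le> norm (tangent_proj y (G y))"
      using L[OF y h_def] norm_triangle_ineq2[of "L h" "tangent_proj y (G y)"]
      by linarith
    then have "\<mu> / 2 * norm h \<le> norm (tangent_proj y (G y))"
      by (simp add: field_simps)
    then show "\<mu> / 2 * norm (y - z) \<le> norm (riem_grad g y)"
      by (simp add: riem_grad_sphere[OF y] h_def)
  qed
qed

text \<open>A local Polyak-Lojasiewicz inequality: the linear error bound, squared, is inserted into
  the quadratic upper bound.\<close>

lemma local_gradient_domination: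
  assumes z: "norm z = 1" and crit: "tangent_proj z (G z) = 0"
    and pos: "\<And>v. v \<in> tangent_space z \<Longrightarrow> v \<noteq> 0 \<Longrightarrow> v \<bullet> H z v - (G z \<bullet> z) * (norm v)\<^sup>2 > 0"
  obtains C d where "C > 0" "d > 0"
    "\<And>y. norm y = 1 \<Longrightarrow> norm (y - z) < d \<Longrightarrow> g y - g z \<le> C * (norm (riem_grad g y))\<^sup>2"
proof -
  obtain C d where C: "C > 0" "d > 0"
    "\<And>y. norm y = 1 \<Longrightarrow> norm (y - z) < d \<Longrightarrow> g y - g z \<le> C * (norm (y - z))\<^sup>2"
    using local_quadratic_upper_bound[OF z crit] by blast
  obtain c d' where c: "c > 0" "d' > 0"
    "\<And>y. norm y = 1 \<Longrightarrow> norm (y - z) < d' \<Longrightarrow> c * norm (y - z) \<le> norm (riem_grad g y)"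
    using local_error_bound[OF z crit pos] by blast
  show ?thesis
  proof (rule that[of "C / c\<^sup>2" "min d d'"])
    fix y :: "real ^ 'n"
    assume y: "norm y = 1" "norm (y - z) < min d d'"
    have "(c * norm (y - z))\<^sup>2 \<le> (norm (riem_grad g y))\<^sup>2"
      using c(1) c(3)[OF y(1)] y(2) by (intro power_mono) auto
    then have "(norm (y - z))\<^sup>2 \<le> (norm (riem_grad g y))\<^sup>2 / c\<^sup>2"
      using c(1) by (simp add: power_mult_distrib field_simps)
    from mult_left_mono[OF this less_imp_le[OF C(1)]] C(3)[OF y(1)] y(2)
    show "g y - g z \<le> C / c\<^sup>2 * (norm (riem_grad g y))\<^sup>2"
      by simp
  qed (use C c in auto)
qed

end

section \<open>The Hadamard parametrization\<close>

lemma bounded_bilinear_times_vec: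
  "bounded_bilinear ((*) :: real ^ 'n \<Rightarrow> real ^ 'n \<Rightarrow> real ^ 'n)"
  by (subst bilinear_conv_bounded_bilinear[symmetric])
    (auto simp: bilinear_def linear_iff vec_eq_iff algebra_simps)

lemma bounded_bilinear_matrix_vector_mult:
  "bounded_bilinear ((*v) :: real ^ 'n ^ 'm \<Rightarrow> real ^ 'n \<Rightarrow> real ^ 'm)"
  by (subst bilinear_conv_bounded_bilinear[symmetric])
    (auto simp: bilinear_def linear_iff vec_eq_iff matrix_vector_mult_def algebra_simps
      sum.distrib sum_distrib_left)

lemma square_has_derivative: "((\<lambda>z. z * z) has_derivative (\<lambda>h. 2 *\<^sub>R (z * h))) (at (z :: real ^ 'n))"
proof -
  have "((\<lambda>z. z * z) has_derivative (\<lambda>h. z * h + h * z)) (at z)"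
    by (rule bounded_bilinear.FDERIV[OF bounded_bilinear_times_vec]) (auto intro: derivative_eq_intros)
  moreover have "(\<lambda>h. z * h + h * z) = (\<lambda>h. 2 *\<^sub>R (z * h))"
    by (auto simp: vec_eq_iff)
  ultimately show ?thesis by simp
qed

lemma tendsto_square:
  assumes "(zs \<longlongrightarrow> (z :: real ^ 'n)) F"
  shows "((\<lambda>k. zs k * zs k) \<longlongrightarrow> z * z) F"
  by (rule bounded_bilinear.tendsto[OF bounded_bilinear_times_vec assms assms])

lemma inner_times_vec:
  fixes a b c :: "real ^ 'n"
  shows "(a * b) \<bullet> c = b \<bullet> (a * c)"
  by (simp add: inner_vec_def algebra_simps)

text \<open>The adjoint of the derivative, applied to the number \<open>1\<close>, is the vector
  that represents it.\<close>

lemma GDERIV_gradient: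
  fixes f :: "real ^ 'n \<Rightarrow> real"
  assumes "f differentiable (at x)"
  shows "GDERIV f x :> gradient f x"
proof -
  from assms obtain f' where f': "(f has_derivative f') (at x)"
    by (auto simp: differentiable_def)
  have "f' = (\<lambda>h. h \<bullet> adjoint f' 1)"
    using adjoint_works[OF has_derivative_linear[OF f']] by auto
  with f' have "GDERIV f x :> adjoint f' 1"
    by (simp add: gderiv_def)
  then show ?thesis
    unfolding gradient_def by (rule theI) (blast intro: GDERIV_unique \<open>GDERIV f x :> adjoint f' 1\<close>)
qed

lemma inner_one_times_vec:
  fixes a b :: "real ^ 'n"
  shows "1 \<bullet> (a * b) = a \<bullet> b"
  by (simp add: inner_vec_def)

definition hadamard_grad :: "(real ^ 'n \<Rightarrow> real) \<Rightarrow> real ^ 'n \<Rightarrow> real ^ 'n" where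
  "hadamard_grad f z = 2 *\<^sub>R (z * gradient f (z * z))"

text \<open>The Euclidean Hessian of \<open>hadamard_obj f\<close> at \<open>z\<close>, applied to
  \<open>h\<close>, in the form that the product and chain rules produce.\<close>

definition hadamard_hess :: "(real ^ 'n \<Rightarrow> real) \<Rightarrow> real ^ 'n \<Rightarrow> real ^ 'n \<Rightarrow> real ^ 'n" where
  "hadamard_hess f z h =
     2 *\<^sub>R (z * (hessian f (z * z) *v (2 *\<^sub>R (z * h))) + h * gradient f (z * z))"

context
  fixes f :: "real ^ 'n \<Rightarrow> real"
  assumes f: "twice_cont_differentiable f"
begin

lemma gderiv_twice: "GDERIV f x :> gradient f x"
  using f by (intro GDERIV_gradient) (simp add: twice_cont_differentiable_def differentiable_on_def)

lemma gradient_has_derivative: "(gradient f has_derivative (\<lambda>h. hessian f x *v h)) (at x)"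
  using f unfolding hessian_def
  by (intro jacobian_works[THEN iffD1]) (simp add: twice_cont_differentiable_def differentiable_on_def)

lemma isCont_gradient: "isCont (gradient f) x"
  using gradient_has_derivative has_derivative_continuous by blast

lemma isCont_hessian: "isCont (hessian f) x"
  using f by (simp add: twice_cont_differentiable_def continuous_on_eq_continuous_at)

lemma twice_differentiable_hadamard_obj:
  "twice_differentiable_function (hadamard_obj f) (hadamard_grad f) (hadamard_hess f)"
proof
  fix z :: "real ^ 'n"
  have "((\<lambda>z. f (z * z)) has_derivative (\<lambda>h. (2 *\<^sub>R (z * h)) \<bullet> gradient f (z * z))) (at z)"
    by (rule has_derivative_compose[OF square_has_derivative gderiv_twice[unfolded gderiv_def]])
  then show "GDERIV (hadamard_obj f) z :> hadamard_grad f z"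
    by (simp add: gderiv_def hadamard_obj_def[abs_def] hadamard_grad_def inner_times_vec)
  have "((\<lambda>z. gradient f (z * z)) has_derivative (\<lambda>h. hessian f (z * z) *v (2 *\<^sub>R (z * h)))) (at z)"
    by (rule has_derivative_compose[OF square_has_derivative gradient_has_derivative])
  from bounded_bilinear.FDERIV[OF bounded_bilinear_times_vec has_derivative_ident this]
  show "(hadamard_grad f has_derivative hadamard_hess f z) (at z)"
    unfolding hadamard_grad_def[abs_def] hadamard_hess_def[abs_def]
    by (rule has_derivative_scaleR_right)
qed

interpretation twice_differentiable_function "hadamard_obj f" "hadamard_grad f" "hadamard_hess f"
  by (rule twice_differentiable_hadamard_obj)

lemma tendsto_hadamard_grad:
  assumes "(zs \<longlongrightarrow> z) F"
  shows "((\<lambda>k. hadamard_grad f (zs k)) \<longlongrightarrow> hadamard_grad f z) F"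
  unfolding hadamard_grad_def
  by (intro tendsto_intros bounded_bilinear.tendsto[OF bounded_bilinear_times_vec] assms
      isCont_tendsto_compose[OF isCont_gradient] tendsto_square)

lemma tendsto_hadamard_hess:
  assumes "(zs \<longlongrightarrow> z) F" "(vs \<longlongrightarrow> v) F"
  shows "((\<lambda>k. hadamard_hess f (zs k) (vs k)) \<longlongrightarrow> hadamard_hess f z v) F"
  unfolding hadamard_hess_def
  by (intro tendsto_intros bounded_bilinear.tendsto[OF bounded_bilinear_times_vec]
      bounded_bilinear.tendsto[OF bounded_bilinear_matrix_vector_mult] assms
      isCont_tendsto_compose[OF isCont_gradient] isCont_tendsto_compose[OF isCont_hessian]
      tendsto_square)

text \<open>For a unit \<open>z\<close> and tangent \<open>v\<close> the left-hand side is the form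
  of the Riemannian Hessian. On the right, the first term sees \<open>v\<close> only on the support
  of \<open>z\<close>; at a critical point the vector in the second is the multiplier
  \<open>\<beta>\<close>.\<close>

lemma hadamard_quadratic_form:
  defines "l z \<equiv> gradient f (z * z) \<bullet> (z * z)"
  shows "v \<bullet> hadamard_hess f z v - (hadamard_grad f z \<bullet> z) * (norm v)\<^sup>2 =
     4 * ((z * v) \<bullet> (hessian f (z * z) *v (z * v))) +
     2 * ((gradient f (z * z) - l z *\<^sub>R 1) \<bullet> (v * v))"
proof -
  have "v \<bullet> (v * gradient f (z * z)) = gradient f (z * z) \<bullet> (v * v)"
    by (simp add: inner_vec_def algebra_simps)
  moreover have "(norm v)\<^sup>2 = 1 \<bullet> (v * v)"
    by (simp add: power2_norm_eq_inner inner_one_times_vec)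
  moreover have "hadamard_grad f z \<bullet> z = 2 * l z"
    by (simp add: hadamard_grad_def l_def inner_vec_def sum_distrib_left algebra_simps)
  moreover have "v \<bullet> (z * w) = (z * v) \<bullet> w" for w
    by (simp add: inner_vec_def algebra_simps)
  then have "v \<bullet> hadamard_hess f z v =
      4 * ((z * v) \<bullet> (hessian f (z * z) *v (z * v))) + 2 * (v \<bullet> (v * gradient f (z * z)))"
    by (simp add: hadamard_hess_def inner_add_right
        bounded_bilinear.scaleR_right[OF bounded_bilinear_matrix_vector_mult])
  ultimately show ?thesis
    by (simp add: inner_diff_left)
qed

section \<open>From stationarity on the sphere to KKT points and back\<close>

text \<open>Criticality gives complementarity. Suitable tangent vectors then isolate the two terms
  of the form: those off the support of \<open>z\<close> give the sign of \<open>\<beta>\<close>,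
  those on it the curvature of \<open>f\<close>.\<close>

lemma second_order_kkt_square:
  assumes z: "norm z = 1" and crit: "tangent_proj z (hadamard_grad f z) = 0"
    and psd: "\<And>v. v \<in> tangent_space z \<Longrightarrow>
      0 \<le> v \<bullet> hadamard_hess f z v - (hadamard_grad f z \<bullet> z) * (norm v)\<^sup>2"
  shows "second_order_kkt f (z * z)"
proof -
  define l where "l = gradient f (z * z) \<bullet> (z * z)"
  define \<beta> where "\<beta> = gradient f (z * z) - l *\<^sub>R 1"
  have "hadamard_grad f z \<bullet> z = 2 * l"
    by (simp add: hadamard_grad_def l_def inner_vec_def sum_distrib_left algebra_simps)
  then have "hadamard_grad f z = (2 * l) *\<^sub>R z"
    using crit by (simp add: tangent_proj_def)
  then have "2 * (z $ i * gradient f (z * z) $ i) = 2 * (l * z $ i)" for i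
    by (simp add: hadamard_grad_def vec_eq_iff)
  then have z\<beta>: "z $ i * \<beta> $ i = 0" for i
    by (simp add: \<beta>_def algebra_simps)
  have qf: "0 \<le> 2 * ((z * v) \<bullet> (hessian f (z * z) *v (z * v))) + \<beta> \<bullet> (v * v)"
    if "v \<in> tangent_space z" for v
    using psd[OF that] hadamard_quadratic_form[of v z] by (simp add: \<beta>_def l_def)
  have \<beta>: "0 \<le> \<beta> $ i" for i
  proof (cases "z $ i = 0")
    case True
    \<comment> \<open>At a zero of \<open>z\<close> the coordinate vector is tangent and
      multiplication by \<open>z\<close> kills it, so the form reduces to the entry of
      \<open>\<beta>\<close>.\<close>
    have "z * axis i 1 = 0"
      using True by (simp add: vec_eq_iff axis_def)
    moreover have "axis i 1 \<in> tangent_space z"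
      using True by (simp add: tangent_space_def inner_commute inner_axis)
    moreover have "axis i 1 * axis i 1 = (axis i 1 :: real ^ 'n)"
      by (simp add: vec_eq_iff axis_def)
    ultimately show ?thesis
      using qf[of "axis i 1"] by (simp add: inner_axis)
  qed (use z\<beta>[of i] in simp)
  have "kkt f (z * z) l \<beta>"
    unfolding kkt_def
  proof (intro conjI)
    show "gradient f (z * z) = l *\<^sub>R 1 + \<beta>"
      by (simp add: \<beta>_def)
    show "0 \<le> z * z" "0 \<le> \<beta>"
      using \<beta> by (simp_all add: less_eq_vec_def)
    show "z * z * \<beta> = 0"
      using z\<beta> by (simp add: vec_eq_iff)
    show "1 \<bullet> (z * z) = 1"
      using z by (simp add: norm_eq_1 inner_one_times_vec)
  qed
  moreover have "0 \<le> u \<bullet> (hessian f (z * z) *v u)" if u: "u \<in> critical_directions (z * z)" for u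
  proof -
    \<comment> \<open>Where \<open>z\<close> vanishes, so does \<open>u\<close>, and division by
      zero gives \<open>0\<close> as required. Tangency of \<open>v\<close> is the condition that
      the entries of \<open>u\<close> sum to zero.\<close>
    define v where "v = (\<chi> i. u $ i / z $ i)"
    have zv: "z * v = u"
      using u by (auto simp: v_def vec_eq_iff critical_directions_def)
    then have "v \<in> tangent_space z"
      using u inner_one_times_vec[of z v]
      by (simp add: tangent_space_def critical_directions_def inner_commute)
    from qf[OF this] have "0 \<le> 2 * (u \<bullet> (hessian f (z * z) *v u)) + \<beta> \<bullet> (v * v)"
      by (simp add: zv)
    \<comment> \<open>Here \<open>v\<close> vanishes off the support of \<open>z\<close>, and
      \<open>\<beta>\<close> vanishes on it.\<close>
    moreover have "\<beta> $ i * (v $ i * v $ i) = 0" for i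
      using z\<beta>[of i] by (auto simp: v_def)
    then have "\<beta> \<bullet> (v * v) = 0"
      unfolding inner_vec_def by (intro sum.neutral) simp
    ultimately show ?thesis by simp
  qed
  ultimately show ?thesis
    unfolding second_order_kkt_def by blast
qed

text \<open>If \<open>z * v\<close> is nonzero, it is a critical direction and the Hessian of
  \<open>f\<close> is positive there. Otherwise \<open>v\<close> lives where \<open>z\<close>
  vanishes, and strict complementarity makes the multiplier term positive.\<close>

lemma hadamard_quadratic_form_pos:
  assumes x: "nondegenerate_second_order_kkt f (z * z)"
    and v: "v \<in> tangent_space z" "v \<noteq> 0"
  shows "0 < v \<bullet> hadamard_hess f z v - (hadamard_grad f z \<bullet> z) * (norm v)\<^sup>2"
proof -
  from x obtain l \<beta> where kkt: "kkt f (z * z) l \<beta>"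
    and strict: "\<And>j. z $ j = 0 \<Longrightarrow> \<beta> $ j > 0"
    and pos: "\<And>u. u \<in> critical_directions (z * z) \<Longrightarrow> u \<noteq> 0 \<Longrightarrow> u \<bullet> (hessian f (z * z) *v u) > 0"
    by (auto simp: nondegenerate_second_order_kkt_def)
  have \<beta>0: "\<beta> $ i \<ge> 0" for i
    using kkt by (simp add: kkt_def less_eq_vec_def)
  \<comment> \<open>Complementarity and the unit sum of \<open>z * z\<close> force the given
    multiplier \<open>l\<close> to be the one in \<open>hadamard_quadratic_form\<close>.\<close>
  have "\<beta> \<bullet> (z * z) = 1 \<bullet> (z * z * \<beta>)"
    by (simp add: inner_vec_def mult.commute)
  then have "gradient f (z * z) \<bullet> (z * z) = l"
    using kkt by (simp add: kkt_def inner_add_left)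
  then have \<beta>: "gradient f (z * z) - (gradient f (z * z) \<bullet> (z * z)) *\<^sub>R 1 = \<beta>"
    using kkt by (simp add: kkt_def)
  have sum: "\<beta> \<bullet> (v * v) = (\<Sum>i\<in>UNIV. \<beta> $ i * (v $ i)\<^sup>2)"
    by (simp add: inner_vec_def power2_eq_square)
  have \<beta>v: "\<beta> \<bullet> (v * v) \<ge> 0"
    unfolding sum using \<beta>0 by (intro sum_nonneg) simp
  have crit: "z * v \<in> critical_directions (z * z)"
    using v by (simp add: critical_directions_def tangent_space_def inner_one_times_vec inner_commute)
  have "0 < 4 * ((z * v) \<bullet> (hessian f (z * z) *v (z * v))) + 2 * (\<beta> \<bullet> (v * v))"
  proof (cases "z * v = 0")
    case True
    obtain i where i: "v $ i \<noteq> 0"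
      using v(2) by (auto simp: vec_eq_iff)
    with True have "z $ i = 0"
      by (metis mult_eq_0_iff vector_mult_component zero_index)
    with i have "0 < \<beta> $ i * (v $ i)\<^sup>2"
      using strict by simp
    then have "0 < \<beta> \<bullet> (v * v)"
      unfolding sum using \<beta>0 by (intro sum_pos2[of _ i]) auto
    with True show ?thesis by simp
  next
    case False
    then show ?thesis
      using pos[OF crit] \<beta>v by simp
  qed
  then show ?thesis
    by (simp add: hadamard_quadratic_form \<beta>)
qed

section \<open>Limits of approximately stationary points and compactness\<close>

text \<open>The gradient and curvature conditions are closed, because the first two derivatives of
  \<open>f\<close> are continuous; as the tolerance vanishes they become exact.\<close>

lemma limit_second_order_kkt:
  assumes zs: "zs \<longlonglongrightarrow> z" and e: "e \<longlonglongrightarrow> 0"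
    and stat: "\<And>k. approx_second_order_stationary (hadamard_obj f) \<rho> (e k) (zs k)"
  shows "norm z = 1" "tangent_proj z (hadamard_grad f z) = 0" "second_order_kkt f (z * z)"
proof -
  have unit: "norm (zs k) = 1" for k
    using stat[of k] by (simp add: approx_second_order_stationary_def)
  then have "(\<lambda>_. 1) \<longlonglongrightarrow> norm z"
    using tendsto_norm[OF zs] by simp
  then show z: "norm z = 1"
    by (simp add: LIMSEQ_const_iff)
  have lim: "(\<lambda>k. tangent_proj (zs k) (hadamard_grad f (zs k))) \<longlonglongrightarrow> tangent_proj z (hadamard_grad f z)"
    unfolding tangent_proj_def by (intro tendsto_intros tendsto_hadamard_grad zs)
  have "norm (tangent_proj z (hadamard_grad f z)) \<le> 0"
  proof (rule LIMSEQ_le[OF tendsto_norm[OF lim] e])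
    show "\<exists>N. \<forall>k\<ge>N. norm (tangent_proj (zs k) (hadamard_grad f (zs k))) \<le> e k"
      using stat unit riem_grad_sphere by (auto simp: approx_second_order_stationary_def)
  qed
  then show crit: "tangent_proj z (hadamard_grad f z) = 0" by simp
  have "0 \<le> v \<bullet> hadamard_hess f z v - (hadamard_grad f z \<bullet> z) * (norm v)\<^sup>2"
    if v: "v \<in> tangent_space z" for v
  proof -
    \<comment> \<open>The tangent space varies with \<open>k\<close>, so the fixed \<open>v\<close>
      is projected to the one at \<open>zs k\<close>; the projections converge to
      \<open>v\<close>.\<close>
    define vs where "vs k = tangent_proj (zs k) v" for k
    have "vs \<longlonglongrightarrow> tangent_proj z v"
      unfolding vs_def tangent_proj_def by (intro tendsto_intros zs)
    then have vs: "vs \<longlonglongrightarrow> v"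
      using v by (simp add: tangent_proj_def tangent_space_def)
    have "(\<lambda>k. - sqrt (\<rho> * e k) * (norm (vs k))\<^sup>2) \<longlonglongrightarrow> - sqrt (\<rho> * 0) * (norm v)\<^sup>2"
      by (intro tendsto_intros e vs)
    moreover have "(\<lambda>k. vs k \<bullet> hadamard_hess f (zs k) (vs k) - (hadamard_grad f (zs k) \<bullet> zs k) * (norm (vs k))\<^sup>2)
        \<longlonglongrightarrow> v \<bullet> hadamard_hess f z v - (hadamard_grad f z \<bullet> z) * (norm v)\<^sup>2"
      by (intro tendsto_intros tendsto_hadamard_grad tendsto_hadamard_hess zs vs)
    moreover have "- sqrt (\<rho> * e k) * (norm (vs k))\<^sup>2 \<le>
        vs k \<bullet> hadamard_hess f (zs k) (vs k) - (hadamard_grad f (zs k) \<bullet> zs k) * (norm (vs k))\<^sup>2" for k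
      using stat[of k] unit[of k] tangent_proj_in_tangent_space[OF unit]
      by (intro riem_hess_lambda_min_le_quotient)
        (auto simp: approx_second_order_stationary_def vs_def)
    ultimately have "- sqrt (\<rho> * 0) * (norm v)\<^sup>2 \<le>
        v \<bullet> hadamard_hess f z v - (hadamard_grad f z \<bullet> z) * (norm v)\<^sup>2"
      by (intro LIMSEQ_le) auto
    then show ?thesis by simp
  qed
  then show "second_order_kkt f (z * z)"
    by (rule second_order_kkt_square[OF z crit])
qed

text \<open>
  By compactness of the sphere it suffices to look near a limit of stationary points with vanishing
  tolerance, and there the gradient dominates the objective gap.
\<close>
lemma stationary_gap_quadratic:
  assumes saddle: "strict_saddle_property f"
    and global: "\<And>x. local_minimizer f x \<Longrightarrow> global_minimizer f x"
    and nondeg: "\<And>x. second_order_kkt f x \<Longrightarrow> nondegenerate_second_order_kkt f x"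
  obtains C e0 where "C > 0" "e0 > 0"
    "\<And>e z. 0 < e \<Longrightarrow> e < e0 \<Longrightarrow> approx_second_order_stationary (hadamard_obj f) \<rho> e z \<Longrightarrow>
      f (z * z) - (INF x \<in> prob_simplex. f x) \<le> C * e\<^sup>2"
proof (rule ccontr)
  assume contr: "\<not> thesis"
  \<comment> \<open>Failure is used with the constant \<open>Suc k\<close> and its inverse as
    threshold, so the tolerances vanish while the ratio of gap to squared tolerance is
    unbounded.\<close>
  have "\<exists>e z. 0 < e \<and> e < inverse (real (Suc k)) \<and> approx_second_order_stationary (hadamard_obj f) \<rho> e z \<and>
      real (Suc k) * e\<^sup>2 < f (z * z) - (INF x \<in> prob_simplex. f x)" for k
    using contr that[of "real (Suc k)" "inverse (real (Suc k))"] by (force simp: not_le)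
  then obtain e zs where ez: "\<And>k. 0 < e k" "\<And>k. e k < inverse (real (Suc k))"
    "\<And>k. approx_second_order_stationary (hadamard_obj f) \<rho> (e k) (zs k)"
    "\<And>k. real (Suc k) * (e k)\<^sup>2 < f (zs k * zs k) - (INF x \<in> prob_simplex. f x)"
    by metis
  have sph: "zs k \<in> sphere 0 1" for k
    using ez(3)[of k] by (simp add: approx_second_order_stationary_def)
  have e0: "e \<longlonglongrightarrow> 0"
    by (rule tendsto_sandwich[OF _ _ tendsto_const LIMSEQ_inverse_real_of_nat])
      (use ez(1,2) in \<open>auto intro!: always_eventually less_imp_le\<close>)
  obtain r z where r: "strict_mono (r :: nat \<Rightarrow> nat)" and lim: "(zs \<circ> r) \<longlonglongrightarrow> z"
    using compact_sphere[of 0 1] sph unfolding compact_def by blast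
  have lim_e: "(e \<circ> r) \<longlonglongrightarrow> 0"
    by (rule LIMSEQ_subseq_LIMSEQ[OF e0 r])
  have "approx_second_order_stationary (hadamard_obj f) \<rho> ((e \<circ> r) k) ((zs \<circ> r) k)" for k
    using ez(3) by simp
  note z = limit_second_order_kkt[OF lim lim_e this]
  have "global_minimizer f (z * z)"
    using z(3) saddle global by (simp add: strict_saddle_property_def)
  \<comment> \<open>The limit attains the minimum, so the gap can be measured from its
    value.\<close>
  then have inf: "(INF x \<in> prob_simplex. f x) = f (z * z)"
    by (intro cInf_eq_minimum) (auto simp: global_minimizer_def)
  obtain C d where C: "C > 0" "d > 0"
    "\<And>y. norm y = 1 \<Longrightarrow> norm (y - z) < d \<Longrightarrow>
      hadamard_obj f y - hadamard_obj f z \<le> C * (norm (riem_grad (hadamard_obj f) y))\<^sup>2"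
    using local_gradient_domination[OF z(1,2) hadamard_quadratic_form_pos[OF nondeg[OF z(3)]]] by blast
  have "\<forall>\<^sub>F k in sequentially. dist ((zs \<circ> r) k) z < d"
    using lim C(2) by (rule tendstoD)
  \<comment> \<open>Since \<open>r k \<ge> k\<close>, the factor \<open>Suc (r k)\<close> then
    exceeds the constant of the local bound, which contradicts the choice of the sequence.\<close>
  moreover have "\<forall>\<^sub>F k in sequentially. C < real k"
    by (rule eventually_gt_at_top[THEN filterlim_real_sequentially[THEN filterlim_iff[THEN iffD1], rule_format]])
  ultimately obtain k where k: "dist (zs (r k)) z < d" "C < real k"
    using eventually_happens'[OF sequentially_bot eventually_conj] by fastforce
  have "f (zs (r k) * zs (r k)) - (INF x \<in> prob_simplex. f x) \<le>
      C * (norm (riem_grad (hadamard_obj f) (zs (r k))))\<^sup>2"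
    using C(3)[of "zs (r k)"] k(1) sph[of "r k"] by (simp add: inf hadamard_obj_def dist_norm)
  also have "\<dots> \<le> C * (e (r k))\<^sup>2"
    using C(1) ez(3)[of "r k"]
    by (intro mult_left_mono power_mono) (auto simp: approx_second_order_stationary_def)
  also have "\<dots> \<le> real (Suc (r k)) * (e (r k))\<^sup>2"
    using k(2) seq_suble[OF r, of k] by (intro mult_right_mono) auto
  finally show False
    using ez(4)[of "r k"] by simp
qed

end

section \<open>The iteration bound\<close>

text \<open>The event is a countable union, over the passes of the loop, of preimages under
  measurable maps.\<close>

lemma visits_within_measurable:
  assumes run: "hadprgd_run f x\<^sub>0 e p M \<xi>" and P: "{z. P z} \<in> sets borel"
  shows "visits_within f x\<^sub>0 e p M \<xi> K P \<in> sets M"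
proof -
  let ?path = "\<lambda>j \<omega>. hadprgd_path f x\<^sub>0 e p (\<lambda>i. \<xi> i \<omega>) j"
  have meas: "?path j \<in> M \<rightarrow>\<^sub>M count_space UNIV \<Otimes>\<^sub>M borel" for j
    using run by (simp add: hadprgd_run_def)
  have "{..K} \<times> {z. P z} \<in> sets (count_space UNIV \<Otimes>\<^sub>M borel)"
    using P by (intro pair_measureI) auto
  then have "(\<Union>j. ?path j -` ({..K} \<times> {z. P z}) \<inter> space M) \<in> sets M"
    by (intro sets.countable_UN) (auto intro: measurable_sets[OF meas])
  also have "(\<Union>j. ?path j -` ({..K} \<times> {z. P z}) \<inter> space M) = visits_within f x\<^sub>0 e p M \<xi> K P"
    by (auto simp: visits_within_def)
  finally show ?thesis .
qed

text \<open>Monotonicity of \<open>measure\<close> rests on measurability of the larger event. In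
  the application \<open>Q\<close> describes a closed sublevel set, while \<open>P\<close> is
  approximate stationarity.\<close>

lemma visits_within_measure_mono:
  assumes run: "hadprgd_run f x\<^sub>0 e p M \<xi>" and Q: "{z. Q z} \<in> sets borel"
    and PQ: "\<And>z. P z \<Longrightarrow> Q z"
  shows "measure M (visits_within f x\<^sub>0 e p M \<xi> K P) \<le> measure M (visits_within f x\<^sub>0 e p M \<xi> K Q)"
proof -
  interpret prob_space M
    using run by (simp add: hadprgd_run_def)
  show ?thesis
    by (rule finite_measure_mono[OF _ visits_within_measurable[OF run Q]])
      (use PQ in \<open>auto simp: visits_within_def\<close>)
qed

theorem theorem5:
  fixes f :: "real ^ 'n \<Rightarrow> real"
    and \<rho> \<delta> :: real
    and par :: "real ^ 'n \<Rightarrow> real \<Rightarrow> prgd_params"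
    and M :: "real ^ 'n \<Rightarrow> real \<Rightarrow> 'w measure"
    and \<xi> :: "real ^ 'n \<Rightarrow> real \<Rightarrow> nat \<Rightarrow> 'w \<Rightarrow> real ^ 'n"
    and K\<^sub>0 :: "real \<Rightarrow> nat"
  assumes "twice_cont_differentiable f"
    and "strict_saddle_property f"
    and "\<And>x. local_minimizer f x \<Longrightarrow> global_minimizer f x"
    and "\<And>x. second_order_kkt f x \<Longrightarrow> nondegenerate_second_order_kkt f x"
    (* the runs of the algorithm, one for each initial point and tolerance *)
    and "\<And>x\<^sub>0 e. x\<^sub>0 \<in> prob_simplex \<Longrightarrow> e > 0 \<Longrightarrow>
           valid_params (par x\<^sub>0 e) \<and> hadprgd_run f x\<^sub>0 e (par x\<^sub>0 e) (M x\<^sub>0 e) (\<xi> x\<^sub>0 e)"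
    (* the guarantee of Criscitiello and Boumal for these parameters, with failure probability \<delta> *)
    and "0 < \<delta>" and "\<delta> < 1"
    and "pullback_hess_lipschitz (hadamard_obj f) \<rho>"
    and "(\<lambda>e. real (K\<^sub>0 e)) \<in> O[at_right 0](\<lambda>e. (ln (real CARD('n))) ^ 4 / e ^ 2)"
    and "\<forall>\<^sub>F e in at_right 0. \<forall>x\<^sub>0 \<in> prob_simplex.
           measure (M x\<^sub>0 e) (visits_within f x\<^sub>0 e (par x\<^sub>0 e) (M x\<^sub>0 e) (\<xi> x\<^sub>0 e) (K\<^sub>0 e)
             (approx_second_order_stationary (hadamard_obj f) \<rho> e)) \<ge> 1 - \<delta>"
  shows "\<exists>(tol :: real \<Rightarrow> real) (K :: real \<Rightarrow> nat).
           (\<forall>\<epsilon>>0. tol \<epsilon> > 0) \<and>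
           (\<lambda>\<epsilon>. real (K \<epsilon>)) \<in> O[at_right 0](\<lambda>\<epsilon>. (ln (real CARD('n))) ^ 4 / \<epsilon>) \<and>
           (\<forall>\<^sub>F \<epsilon> in at_right 0. \<forall>x\<^sub>0 \<in> prob_simplex.
              measure (M x\<^sub>0 (tol \<epsilon>))
                (visits_within f x\<^sub>0 (tol \<epsilon>) (par x\<^sub>0 (tol \<epsilon>)) (M x\<^sub>0 (tol \<epsilon>)) (\<xi> x\<^sub>0 (tol \<epsilon>)) (K \<epsilon>)
                  (\<lambda>z. f (z * z) - (INF x \<in> prob_simplex. f x) \<le> \<epsilon>)) \<ge> 1 - \<delta>)"
proof -
  obtain C e0 where C: "C > 0" and e0: "e0 > 0"
    and gap: "\<And>e z. 0 < e \<Longrightarrow> e < e0 \<Longrightarrow> approx_second_order_stationary (hadamard_obj f) \<rho> e z \<Longrightarrow>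
      f (z * z) - (INF x \<in> prob_simplex. f x) \<le> C * e\<^sup>2"
    using stationary_gap_quadratic[OF assms(1-4)] by metis
  define tol where "tol \<epsilon> = sqrt (\<epsilon> / C)" for \<epsilon>
  have tol_pos: "tol \<epsilon> > 0" if "\<epsilon> > 0" for \<epsilon>
    using that C by (simp add: tol_def)
  have tol_sq: "(tol \<epsilon>)\<^sup>2 = \<epsilon> / C" if "\<epsilon> > 0" for \<epsilon>
    using that C by (simp add: tol_def)
  have pos: "\<forall>\<^sub>F \<epsilon>::real in at_right 0. \<epsilon> > 0"
    by (rule eventually_at_right_less)
  have "(tol \<longlongrightarrow> sqrt (0 / C)) (at_right 0)"
    unfolding tol_def using C by (intro tendsto_intros) auto
  \<comment> \<open>The tolerance tends to \<open>0\<close> from the right, so the asymptotic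
    guarantees in the tolerance can be composed with \<open>tol\<close>.\<close>
  then have tol_lim: "filterlim tol (at_right 0) (at_right 0)"
    using pos by (auto simp: filterlim_at elim!: eventually_mono dest: tol_pos)
  show ?thesis
  proof (intro exI[of _ tol] exI[of _ "\<lambda>\<epsilon>. K\<^sub>0 (tol \<epsilon>)"] conjI allI impI tol_pos)
    have "(\<lambda>\<epsilon>. real (K\<^sub>0 (tol \<epsilon>))) \<in> O[at_right 0](\<lambda>\<epsilon>. (ln (real CARD('n))) ^ 4 / (tol \<epsilon>)\<^sup>2)"
      by (rule landau_o.big.compose[OF assms(9) tol_lim])
    \<comment> \<open>The two functions differ by the factor \<open>C\<close>.\<close>
    also have "(\<lambda>\<epsilon>. (ln (real CARD('n))) ^ 4 / (tol \<epsilon>)\<^sup>2) \<in> O[at_right 0](\<lambda>\<epsilon>. (ln (real CARD('n))) ^ 4 / \<epsilon>)"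
      by (rule bigoI[of _ C]) (use pos in \<open>eventually_elim, use C in \<open>simp add: tol_sq mult.commute\<close>\<close>)
    finally show "(\<lambda>\<epsilon>. real (K\<^sub>0 (tol \<epsilon>))) \<in> O[at_right 0](\<lambda>\<epsilon>. (ln (real CARD('n))) ^ 4 / \<epsilon>)" .
    have cont: "continuous_on UNIV (\<lambda>z. f (z * z))"
    proof (rule continuous_on_compose2[of UNIV f])
      show "continuous_on UNIV f"
        by (intro continuous_at_imp_continuous_on ballI
            has_derivative_continuous[OF gderiv_twice[OF assms(1), unfolded gderiv_def]])
      show "continuous_on UNIV (\<lambda>z :: real ^ 'n. z * z)"
        by (intro bounded_bilinear.continuous_on[OF bounded_bilinear_times_vec] continuous_on_id)
    qed simp
    have meas: "{z. f (z * z) - (INF x \<in> prob_simplex. f x) \<le> \<epsilon>} \<in> sets borel" for \<epsilon>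
      by (intro borel_closed closed_Collect_le continuous_intros cont)
    have "\<forall>\<^sub>F e in at_right 0. e < e0"
      using e0 by (rule eventually_at_right_real[THEN eventually_mono]) auto
    with assms(10) have "\<forall>\<^sub>F e in at_right 0. e < e0 \<and> (\<forall>x\<^sub>0 \<in> prob_simplex.
           measure (M x\<^sub>0 e) (visits_within f x\<^sub>0 e (par x\<^sub>0 e) (M x\<^sub>0 e) (\<xi> x\<^sub>0 e) (K\<^sub>0 e)
             (approx_second_order_stationary (hadamard_obj f) \<rho> e)) \<ge> 1 - \<delta>)"
      by eventually_elim blast
    from eventually_compose_filterlim[OF this tol_lim] pos
    show "\<forall>\<^sub>F \<epsilon> in at_right 0. \<forall>x\<^sub>0 \<in> prob_simplex.
              measure (M x\<^sub>0 (tol \<epsilon>))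
                (visits_within f x\<^sub>0 (tol \<epsilon>) (par x\<^sub>0 (tol \<epsilon>)) (M x\<^sub>0 (tol \<epsilon>)) (\<xi> x\<^sub>0 (tol \<epsilon>)) (K\<^sub>0 (tol \<epsilon>))
                  (\<lambda>z. f (z * z) - (INF x \<in> prob_simplex. f x) \<le> \<epsilon>)) \<ge> 1 - \<delta>"
    proof eventually_elim
      case (elim \<epsilon>)
      show ?case
      proof
        fix x\<^sub>0 :: "real ^ 'n"
        assume x\<^sub>0: "x\<^sub>0 \<in> prob_simplex"
        let ?visits = "visits_within f x\<^sub>0 (tol \<epsilon>) (par x\<^sub>0 (tol \<epsilon>)) (M x\<^sub>0 (tol \<epsilon>)) (\<xi> x\<^sub>0 (tol \<epsilon>)) (K\<^sub>0 (tol \<epsilon>))"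
        have "1 - \<delta> \<le> measure (M x\<^sub>0 (tol \<epsilon>)) (?visits (approx_second_order_stationary (hadamard_obj f) \<rho> (tol \<epsilon>)))"
          using elim x\<^sub>0 by blast
        also have "\<dots> \<le> measure (M x\<^sub>0 (tol \<epsilon>)) (?visits (\<lambda>z. f (z * z) - (INF x \<in> prob_simplex. f x) \<le> \<epsilon>))"
        \<comment> \<open>Every approximately stationary iterate has gap at most
          \<open>C * (tol \<epsilon>)\<^sup>2\<close>, which is exactly
          \<open>\<epsilon>\<close>.\<close>
        proof (rule visits_within_measure_mono[OF _ meas])
          show "hadprgd_run f x\<^sub>0 (tol \<epsilon>) (par x\<^sub>0 (tol \<epsilon>)) (M x\<^sub>0 (tol \<epsilon>)) (\<xi> x\<^sub>0 (tol \<epsilon>))"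
            using assms(5)[OF x\<^sub>0 tol_pos] elim by simp
          show "f (z * z) - (INF x \<in> prob_simplex. f x) \<le> \<epsilon>"
            if "approx_second_order_stationary (hadamard_obj f) \<rho> (tol \<epsilon>) z" for z
            using gap[OF tol_pos _ that] elim C by (simp add: tol_sq)
        qed
        finally show "measure (M x\<^sub>0 (tol \<epsilon>)) (?visits (\<lambda>z. f (z * z) - (INF x \<in> prob_simplex. f x) \<le> \<epsilon>)) \<ge> 1 - \<delta>" .
      qed
    qed
  qed
qed

end
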